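(* Let $\mathbf{h}$ be a finite-dimensional vector space over $\mathbb{C}$ with a nondegenerate symmetric bilinear form $\langle\cdot,\cdot\rangle$. The associative subalgebra $\Delta(B_{\mathbf{h}})$ of $B_{\mathbf{h}}\otimes B_{\mathbf{h}}$ is a vertex subalgebra of the smash product $B_{\mathbf{h}}\,\sharp\,B_{\mathbf{h}}$. Furthermore, $\Delta$ viewed as a map from $M_{\hat{\mathbf{h}}}(1,0)$ to $\Delta(B_{\mathbf{h}})$, $$\Delta:\ M_{\hat{\mathbf{h}}}(1,0)=S(\hat{\mathbf{h}}^{-})=B_{\mathbf{h}}\longrightarrow\Delta(B_{\mathbf{h}})\subset B_{\mathbf{h}}\otimes B_{\mathbf{h}}=B_{\mathbf{h}}\,\sharp\,B_{\mathbf{h}},$$ is a vertex algebra isomorphism.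
   Context: All vector spaces are over $\mathbb{C}$; $(x_1\pm x_2)^n$ is expanded in nonnegative powers of the second variable. A nonlocal vertex algebra is a vector space $V$ with a linear map $Y(\cdot,x):V\to\mathrm{Hom}(V,V((x)))$, $v\mapsto Y(v,x)=\sum_{n}v_nx^{-n-1}$, and a vacuum $\mathbf{1}$ such that $Y(\mathbf{1},x)=1$; $Y(v,x)\mathbf{1}\in V[[x]]$ with constant term $v$; and for all $u,v,w\in V$ there is $l\ge0$ with $(x_0+x_2)^lY(u,x_0+x_2)Y(v,x_2)w=(x_0+x_2)^lY(Y(u,x_0)v,x_2)w$. It is an (ordinary) vertex algebra if for all $u,v$ there is $k\ge0$ with $(x_1-x_2)^k[Y(u,x_1),Y(v,x_2)]=0$. A module $(W,Y_W)$ for $V$ satisfies $Y_W:V\to\mathrm{Hom}(W,W((x)))$, $Y_W(\mathbf{1},x)=1_W$ and the analogous weak associativity. Heisenberg data: $\hat{\mathbf{h}}=\mathbf{h}\otimes\mathbb{C}[t,t^{-1}]\oplus\mathbb{C}c$ with $[a\otimes t^m,b\otimes t^n]=m\delta_{m+n,0}\langle a,b\rangle c$, $c$ central; $h(n)=h\otimes t^n$; $\hat{\mathbf{h}}^{-}=\mathbf{h}\otimes t^{-1}\mathbb{C}[t^{-1}]$. $B_{\mathbf{h}}=U(\hat{\mathbf{h}}^{-})=S(\hat{\mathbf{h}}^{-})$ with its usual bialgebra structure (elements of $\hat{\mathbf{h}}^{-}$ are primitive, $\Delta(a)=a\otimes1+1\otimes a$, $\varepsilon(a)=0$), and $L(-1)$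 is the derivation of $B_{\mathbf{h}}$ with $L(-1)h(-n)=nh(-n-1)$ for $n\ge1$. $B_{\mathbf{h}}$ is a (nonlocal) vertex algebra with vacuum $1$ and $Y_{B_{\mathbf{h}}}(a,x)b=(e^{xL(-1)}a)b$, and is a vertex bialgebra, i.e. $\Delta$ and $\varepsilon$ are homomorphisms of nonlocal vertex algebras (with tensor product $Y(u\otimes a,x)=Y(u,x)\otimes Y(a,x)$). For $\alpha\in\mathbf{h}$ let $\alpha(0)=0$ on $B_{\mathbf{h}}$ and, for $n\ge1$, let $\alpha(n)$ be the derivation of $B_{\mathbf{h}}$ with $\alpha(n)\beta(-m)=n\langle\alpha,\beta\rangle\delta_{n,m}$ ($\beta\in\mathbf{h}$, $m\ge1$); for $n<0$, $\alpha(n)$ acts by multiplication. Set $\alpha(x)^{-}=\sum_{n\ge0}\alpha(n)x^{-n-1}$ and $\alpha(x)^{+}=\sum_{n\ge1}\alpha(-n)x^{n-1}$. There is a unique module structure $Y_M$ for the vertex bialgebra $B_{\mathbf{h}}$ on the space $B_{\mathbf{h}}$ with $Y_M(\alpha(-1),x)=\alpha(x)^{-}$ for $\alpha\in\mathbf{h}$, and it makes the vertex algebra $B_{\mathbf{h}}$ a $B_{\mathbf{h}}$-module nonlocal vertex algebra, meaning that for $h,u,v\in B_{\mathbf{h}}$: $Y_M(h,x)v\in B_{\mathbf{h}}\otimes\mathbb{C}((x))$, $Y_M(h,x)1=\varepsilon(h)1$, and $Y_M(h,x_1)Y_{B_{\mathbf{h}}}(u,x_2)v=\sum Y_{B_{\mathbf{h}}}(Y_M(h_{(1)},x_1-x_2)u,x_2)Y_M(h_{(2)},x_1)v$,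 where $\Delta(h)=\sum h_{(1)}\otimes h_{(2)}$. The smash product $B_{\mathbf{h}}\,\sharp\,B_{\mathbf{h}}$ formed with this structure is the nonlocal vertex algebra on $B_{\mathbf{h}}\otimes B_{\mathbf{h}}$ with vacuum $1\otimes1$ and $Y^{\sharp}(u\otimes h,x)(v\otimes k)=\sum Y_{B_{\mathbf{h}}}(u,x)Y_M(h_{(1)},x)v\otimes Y_{B_{\mathbf{h}}}(h_{(2)},x)k$. $M_{\hat{\mathbf{h}}}(1,0)$ (also $M(1)$) is the vector space $S(\hat{\mathbf{h}}^{-})$ with the unique vertex algebra structure $Y_{M(1)}$ (vacuum $1$) such that $Y_{M(1)}(\alpha(-1),x)=\alpha(x)^{+}+\alpha(x)^{-}$ for $\alpha\in\mathbf{h}$. *)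

theory Defs
  imports Complex_Main "HOL-Library.Poly_Mapping" "HOL-Library.Multiset"
begin

section \<open>Complex vector spaces and commutative algebras\<close>

class complex_vector = ab_group_add +
  fixes scaleC :: "complex \<Rightarrow> 'a \<Rightarrow> 'a" (infixr "*\<^sub>C" 75)
  assumes scaleC_add_right: "c *\<^sub>C (x + y) = c *\<^sub>C x + c *\<^sub>C y"
    and scaleC_add_left: "(c + d) *\<^sub>C x = c *\<^sub>C x + d *\<^sub>C x"
    and scaleC_scaleC: "c *\<^sub>C d *\<^sub>C x = (c * d) *\<^sub>C x"
    and scaleC_one: "1 *\<^sub>C x = x"

global_interpretation cvs: vector_space "scaleC :: complex \<Rightarrow> 'a::complex_vector \<Rightarrow> 'a"
  by unfold_locales (simp_all add: scaleC_add_right scaleC_add_left scaleC_scaleC scaleC_one)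

class complex_comm_algebra = complex_vector + comm_ring_1 +
  assumes scaleC_mult_left: "(c *\<^sub>C a) * b = c *\<^sub>C (a * b)"

lemma scaleC_mult_right: "a * (c *\<^sub>C b) = c *\<^sub>C (a * b)"
  for a b :: "'a::complex_comm_algebra"
  by (metis mult.commute scaleC_mult_left)

abbreviation clinear :: "('a::complex_vector \<Rightarrow> 'b::complex_vector) \<Rightarrow> bool"
  where "clinear \<equiv> Vector_Spaces.linear scaleC scaleC"

definition cbilinear ::
    "('a::complex_vector \<Rightarrow> 'b::complex_vector \<Rightarrow> 'c::complex_vector) \<Rightarrow> bool"
  where "cbilinear f \<longleftrightarrow> (\<forall>a. clinear (f a)) \<and> (\<forall>b. clinear (\<lambda>a. f a b))"

definition alg_hom :: "('a::complex_comm_algebra \<Rightarrow> 'b::complex_comm_algebra) \<Rightarrow> bool"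
  where "alg_hom g \<longleftrightarrow> clinear g \<and> g 1 = 1 \<and> (\<forall>a b. g (a * b) = g a * g b)"

definition derivation :: "('a::complex_comm_algebra \<Rightarrow> 'a) \<Rightarrow> bool"
  where "derivation D \<longleftrightarrow> clinear D \<and> (\<forall>a b. D (a * b) = D a * b + a * D b)"

lemma clinearI:
  assumes "\<And>x y. f (x + y) = f x + f y" and "\<And>c x. f (c *\<^sub>C x) = c *\<^sub>C f x"
  shows "clinear f"
  by unfold_locales (simp_all add: assms)

lemma clinearD:
  assumes "clinear f"
  shows "f (x + y) = f x + f y" "f (c *\<^sub>C x) = c *\<^sub>C f x" "f 0 = 0" "f (x - y) = f x - f y"
    "f (- x) = - f x" "f (sum g A) = (\<Sum>x\<in>A. f (g x))"
proof -
  interpret f: Vector_Spaces.linear scaleC scaleC f by (fact assms)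
  show "f (x + y) = f x + f y" "f (c *\<^sub>C x) = c *\<^sub>C f x" "f 0 = 0" "f (x - y) = f x - f y"
    "f (- x) = - f x" "f (sum g A) = (\<Sum>x\<in>A. f (g x))"
    by (simp_all add: f.add f.scale f.zero f.diff f.neg f.sum)
qed

lemma clinear_compose: "clinear f \<Longrightarrow> clinear g \<Longrightarrow> clinear (\<lambda>x. g (f x))"
  by (rule clinearI) (simp_all add: clinearD)

lemma clinear_add: "clinear f \<Longrightarrow> clinear g \<Longrightarrow> clinear (\<lambda>x. f x + g x)"
  by (rule clinearI) (simp_all add: clinearD scaleC_add_right algebra_simps)

lemma clinear_mult_right: "clinear f \<Longrightarrow> clinear (\<lambda>x. f x * b)"
  for b :: "'b::complex_comm_algebra"
  by (rule clinearI) (simp_all add: clinearD scaleC_mult_left distrib_right)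

lemma clinear_mult_left: "clinear f \<Longrightarrow> clinear (\<lambda>x. b * f x)"
  for b :: "'b::complex_comm_algebra"
  by (rule clinearI) (simp_all add: clinearD scaleC_mult_right distrib_left)

lemma cbilinearD:
  assumes "cbilinear f"
  shows "clinear (f a)" "clinear (\<lambda>a. f a b)"
  using assms by (simp_all add: cbilinear_def)

instantiation complex :: complex_comm_algebra
begin
definition scaleC_complex :: "complex \<Rightarrow> complex \<Rightarrow> complex"
  where "scaleC_complex c x = c * x"
instance
  by standard (simp_all add: scaleC_complex_def algebra_simps)
end

lemma clinear_functional:
  fixes x :: "'a::complex_vector"
  assumes "x \<noteq> 0"
  obtains f :: "'a \<Rightarrow> complex" where "clinear f" "f x = 1"
proof -
  interpret vector_space_pair "scaleC :: complex \<Rightarrow> 'a \<Rightarrow> 'a" "scaleC :: complex \<Rightarrow> complex \<Rightarrow> complex" ..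
  have "cvs.independent {x}"
    using assms by simp
  from linear_independent_extend[OF this, of "\<lambda>_. 1"] show ?thesis
    using that by auto
qed

instantiation poly_mapping :: (type, complex_vector) complex_vector
begin
lift_definition scaleC_poly_mapping ::
    "complex \<Rightarrow> ('a \<Rightarrow>\<^sub>0 'b) \<Rightarrow> ('a \<Rightarrow>\<^sub>0 'b)" is "\<lambda>c f a. c *\<^sub>C f a"
  by (erule finite_subset[rotated]) auto
instance
  by standard (transfer, force simp: scaleC_add_right scaleC_add_left scaleC_scaleC scaleC_one)+
end

lemma lookup_scaleC [simp]: "Poly_Mapping.lookup (c *\<^sub>C p) a = c *\<^sub>C Poly_Mapping.lookup p a"
  by transfer simp

lemma scaleC_single [simp]: "c *\<^sub>C Poly_Mapping.single a b = Poly_Mapping.single a (c *\<^sub>C b)"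
  by (rule poly_mapping_eqI) (simp add: lookup_single when_def)

lemma poly_mapping_scaleC_mult:
  fixes p q :: "'a::comm_monoid_add \<Rightarrow>\<^sub>0 complex"
  shows "c *\<^sub>C p = Poly_Mapping.single 0 c * p" "(c *\<^sub>C p) * q = c *\<^sub>C (p * q)"
proof -
  have *: "c *\<^sub>C p = Poly_Mapping.single 0 c * p" for p :: "'a \<Rightarrow>\<^sub>0 complex"
    unfolding mult_map_scale_conv_mult[symmetric]
    by (rule poly_mapping_eqI) (simp add: scaleC_complex_def map.rep_eq when_def)
  show "c *\<^sub>C p = Poly_Mapping.single 0 c * p" "(c *\<^sub>C p) * q = c *\<^sub>C (p * q)"
    by (simp_all add: * mult.assoc)
qed


text \<open>The type \<open>'a \<Rightarrow>\<^sub>0 complex\<close> is the free vector space on \<open>'a\<close>.\<close>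

definition free_lift :: "('a \<Rightarrow> 'b::complex_vector) \<Rightarrow> ('a \<Rightarrow>\<^sub>0 complex) \<Rightarrow> 'b"
  where "free_lift f p = (\<Sum>a\<in>Poly_Mapping.keys p. Poly_Mapping.lookup p a *\<^sub>C f a)"

lemma free_lift_superset:
  assumes "finite A" "Poly_Mapping.keys p \<subseteq> A"
  shows "free_lift f p = (\<Sum>a\<in>A. Poly_Mapping.lookup p a *\<^sub>C f a)"
  unfolding free_lift_def using assms
  by (intro sum.mono_neutral_left) (auto simp: in_keys_iff)

lemma clinear_free_lift: "clinear (free_lift f)"
proof (rule clinearI)
  fix p q :: "'a \<Rightarrow>\<^sub>0 complex" and c
  let ?A = "Poly_Mapping.keys p \<union> Poly_Mapping.keys q"
  have "Poly_Mapping.keys (p + q) \<subseteq> ?A" by (rule Poly_Mapping.keys_add)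
  then show "free_lift f (p + q) = free_lift f p + free_lift f q"
    by (simp add: free_lift_superset[of ?A] lookup_add scaleC_add_left sum.distrib)
  have "Poly_Mapping.keys (c *\<^sub>C p) \<subseteq> Poly_Mapping.keys p"
    by (auto simp: in_keys_iff)
  then show "free_lift f (c *\<^sub>C p) = c *\<^sub>C free_lift f p"
    by (simp add: free_lift_superset[of "Poly_Mapping.keys p"] cvs.scale_sum_right
        scaleC_complex_def scaleC_scaleC)
qed

lemma free_lift_single [simp]: "free_lift f (Poly_Mapping.single a c) = c *\<^sub>C f a"
  by (subst free_lift_superset[of "{a}"]) auto

lemma free_space_eq:
  fixes g h :: "('a \<Rightarrow>\<^sub>0 complex) \<Rightarrow> 'b::complex_vector"
  assumes g: "clinear g" and h: "clinear h"
    and eq: "\<And>a. g (Poly_Mapping.single a 1) = h (Poly_Mapping.single a 1)"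
  shows "g p = h p"
proof -
  have p: "p = free_lift (\<lambda>a. Poly_Mapping.single a 1) p"
    by (rule poly_mapping_eqI)
      (simp add: free_lift_def lookup_sum lookup_single scaleC_complex_def when_def in_keys_iff
        if_distrib sum.If_cases)
  show ?thesis
    by (subst (1 2) p) (simp add: free_lift_def clinearD[OF g] clinearD[OF h] eq
        del: scaleC_single)
qed


section \<open>Tensor products\<close>

text \<open>The tensor product is the free vector space on the set of pairs modulo the bilinearity
  relations.\<close>

definition tensor_relators :: "(('a::complex_vector \<times> 'b::complex_vector) \<Rightarrow>\<^sub>0 complex) set"
  where "tensor_relators =
    {Poly_Mapping.single (a + a', b) 1 - Poly_Mapping.single (a, b) 1
       - Poly_Mapping.single (a', b) 1 | a a' b. True} \<union>
    {Poly_Mapping.single (a, b + b') 1 - Poly_Mapping.single (a, b) 1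
       - Poly_Mapping.single (a, b') 1 | a b b'. True} \<union>
    {Poly_Mapping.single (c *\<^sub>C a, b) 1 - c *\<^sub>C Poly_Mapping.single (a, b) 1 | c a b. True} \<union>
    {Poly_Mapping.single (a, c *\<^sub>C b) 1 - c *\<^sub>C Poly_Mapping.single (a, b) 1 | c a b. True}"

definition tensor_rel ::
    "(('a::complex_vector \<times> 'b::complex_vector) \<Rightarrow>\<^sub>0 complex) \<Rightarrow> (('a \<times> 'b) \<Rightarrow>\<^sub>0 complex) \<Rightarrow> bool"
  where "tensor_rel p q \<longleftrightarrow> p - q \<in> cvs.span tensor_relators"

lemma equivp_tensor_rel: "equivp tensor_rel"
proof (rule equivpI)
  show "reflp tensor_rel"
    by (simp add: reflp_def tensor_rel_def cvs.span_zero)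
  show "symp tensor_rel"
    unfolding symp_def tensor_rel_def by (metis cvs.span_neg minus_diff_eq)
  show "transp tensor_rel"
    unfolding transp_def tensor_rel_def by (clarify, drule (1) cvs.span_add) simp
qed

quotient_type (overloaded) ('a, 'b) tensor =
    "('a::complex_vector \<times> 'b::complex_vector) \<Rightarrow>\<^sub>0 complex" / tensor_rel
  by (rule equivp_tensor_rel)

lift_definition tensor_elem :: "'a::complex_vector \<Rightarrow> 'b::complex_vector \<Rightarrow> ('a, 'b) tensor"
    (infixr "\<otimes>\<^sub>C" 70)
  is "\<lambda>a b. Poly_Mapping.single (a, b) 1" .

instantiation tensor :: (complex_vector, complex_vector) complex_vector
begin
lift_definition zero_tensor :: "('a, 'b) tensor" is 0 .
lift_definition plus_tensor :: "('a, 'b) tensor \<Rightarrow> ('a, 'b) tensor \<Rightarrow> ('a, 'b) tensor"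
  is "(+)"
  unfolding tensor_rel_def by (drule (1) cvs.span_add) (simp add: algebra_simps)
lift_definition minus_tensor :: "('a, 'b) tensor \<Rightarrow> ('a, 'b) tensor \<Rightarrow> ('a, 'b) tensor"
  is "(-)"
  unfolding tensor_rel_def
  by (drule (1) cvs.span_diff) (simp add: algebra_simps)
lift_definition uminus_tensor :: "('a, 'b) tensor \<Rightarrow> ('a, 'b) tensor" is uminus
  unfolding tensor_rel_def by (drule cvs.span_neg) (simp add: algebra_simps)
lift_definition scaleC_tensor :: "complex \<Rightarrow> ('a, 'b) tensor \<Rightarrow> ('a, 'b) tensor" is scaleC
  unfolding tensor_rel_def by (simp flip: cvs.scale_right_diff_distrib add: cvs.span_scale)
instance
proof
  have eq: "p = q \<Longrightarrow> tensor_rel p q" for p q :: "('a \<times> 'b) \<Rightarrow>\<^sub>0 complex"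
    by (simp add: equivp_reflp[OF equivp_tensor_rel])
  fix x y z :: "('a, 'b) tensor" and c d :: complex
  show "x + y + z = x + (y + z)" by transfer (rule eq, simp add: add.assoc)
  show "x + y = y + x" by transfer (rule eq, simp add: add.commute)
  show "0 + x = x" by transfer (rule eq, simp)
  show "- x + x = 0" by transfer (rule eq, simp)
  show "x - y = x + - y" by transfer (rule eq, simp)
  show "c *\<^sub>C (x + y) = c *\<^sub>C x + c *\<^sub>C y" by transfer (rule eq, simp add: scaleC_add_right)
  show "(c + d) *\<^sub>C x = c *\<^sub>C x + d *\<^sub>C x" by transfer (rule eq, simp add: scaleC_add_left)
  show "c *\<^sub>C d *\<^sub>C x = (c * d) *\<^sub>C x" by transfer (rule eq, simp add: scaleC_scaleC)
  show "1 *\<^sub>C x = x" by transfer (rule eq, simp add: scaleC_one)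
qed
end

lemma clinear_abs_tensor: "clinear abs_tensor"
  by (rule clinearI) (simp_all add: plus_tensor.abs_eq scaleC_tensor.abs_eq)

lemma tensor_elem_abs: "a \<otimes>\<^sub>C b = abs_tensor (Poly_Mapping.single (a, b) 1)"
  by (simp add: tensor_elem.abs_eq)

lemma abs_tensor_eq_0: "p \<in> tensor_relators \<Longrightarrow> abs_tensor p = 0"
  by (simp add: zero_tensor_def tensor.abs_eq_iff tensor_rel_def cvs.span_base)

lemma cbilinear_tensor_elem: "cbilinear (\<otimes>\<^sub>C)"
proof -
  have rel: "abs_tensor p = abs_tensor q" if "p - q \<in> tensor_relators"
    for p q :: "('a \<times> 'b) \<Rightarrow>\<^sub>0 complex"
    using abs_tensor_eq_0[OF that] by (simp add: clinearD[OF clinear_abs_tensor])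
  note [simp del] = scaleC_single
  have "(a + a') \<otimes>\<^sub>C b = a \<otimes>\<^sub>C b + a' \<otimes>\<^sub>C b" for a a' :: 'a and b :: 'b
    unfolding tensor_elem_abs clinearD(1)[OF clinear_abs_tensor, symmetric]
    by (rule rel) (unfold tensor_relators_def diff_diff_eq[symmetric], blast)
  moreover have "a \<otimes>\<^sub>C (b + b') = a \<otimes>\<^sub>C b + a \<otimes>\<^sub>C b'" for a :: 'a and b b' :: 'b
    unfolding tensor_elem_abs clinearD(1)[OF clinear_abs_tensor, symmetric]
    by (rule rel) (unfold tensor_relators_def diff_diff_eq[symmetric], blast)
  moreover have "(c *\<^sub>C a) \<otimes>\<^sub>C b = c *\<^sub>C (a \<otimes>\<^sub>C b)" for a :: 'a and b :: 'b and c
    unfolding tensor_elem_abs clinearD(2)[OF clinear_abs_tensor, symmetric]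
    by (rule rel) (unfold tensor_relators_def, blast)
  moreover have "a \<otimes>\<^sub>C (c *\<^sub>C b) = c *\<^sub>C (a \<otimes>\<^sub>C b)" for a :: 'a and b :: 'b and c
    unfolding tensor_elem_abs clinearD(2)[OF clinear_abs_tensor, symmetric]
    by (rule rel) (unfold tensor_relators_def, blast)
  ultimately show ?thesis
    unfolding cbilinear_def by (intro conjI allI clinearI) simp_all
qed

lemma tensor_eq:
  assumes g: "clinear g" and h: "clinear h" and eq: "\<And>a b. g (a \<otimes>\<^sub>C b) = h (a \<otimes>\<^sub>C b)"
  shows "g t = h t"
proof (induct t rule: tensor.abs_induct)
  case (1 p)
  show ?case
    by (rule free_space_eq[OF clinear_compose[OF clinear_abs_tensor g]
          clinear_compose[OF clinear_abs_tensor h]])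
      (use eq in \<open>auto simp: tensor_elem_abs\<close>)
qed

definition tensor_lift ::
    "('a::complex_vector \<Rightarrow> 'b::complex_vector \<Rightarrow> 'c::complex_vector) \<Rightarrow> ('a, 'b) tensor \<Rightarrow> 'c"
  where "tensor_lift f = (THE g. clinear g \<and> (\<forall>a b. g (a \<otimes>\<^sub>C b) = f a b))"

lemma tensor_lift:
  assumes f: "cbilinear f"
  shows "clinear (tensor_lift f)" "tensor_lift f (a \<otimes>\<^sub>C b) = f a b"
proof -
  let ?F = "free_lift (\<lambda>(a, b). f a b)"
  have F0: "?F p = 0" if "p \<in> cvs.span tensor_relators" for p
    using that
  proof (induction rule: cvs.span_induct_alt)
    case base show ?case by (simp add: clinearD[OF clinear_free_lift])
  next
    case (step c x y)
    then have "?F x = 0"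
      by (auto simp: tensor_relators_def clinearD[OF clinear_free_lift] scaleC_complex_def
          clinearD[OF cbilinearD(1)[OF f]] clinearD[OF cbilinearD(2)[OF f]] scaleC_one)
    with step show ?case by (simp add: clinearD[OF clinear_free_lift])
  qed
  have Feq: "?F p = ?F q" if "abs_tensor p = abs_tensor q" for p q
    using F0[of "p - q"] that
    by (simp add: tensor.abs_eq_iff tensor_rel_def clinearD[OF clinear_free_lift])
  define g where "g t = ?F (rep_tensor t)" for t
  have g_abs: "g (abs_tensor p) = ?F p" for p
    unfolding g_def
    by (rule Feq) (metis Quotient3_tensor Quotient3_abs_rep)
  have "clinear g"
  proof (rule clinearI)
    fix x y :: "('a, 'b) tensor" and c
    have "\<exists>p. z = abs_tensor p" for z :: "('a, 'b) tensor"
      by (induct z rule: tensor.abs_induct) auto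
    then obtain p q where x: "x = abs_tensor p" and y: "y = abs_tensor q"
      by blast
    show "g (x + y) = g x + g y" "g (c *\<^sub>C x) = c *\<^sub>C g x"
      unfolding x y clinearD[OF clinear_abs_tensor, symmetric] g_abs
      by (simp_all add: clinearD[OF clinear_free_lift])
  qed
  moreover have "g (a \<otimes>\<^sub>C b) = f a b" for a b
    by (simp add: tensor_elem_abs g_abs scaleC_one)
  ultimately have "\<exists>!g. clinear g \<and> (\<forall>a b. g (a \<otimes>\<^sub>C b) = f a b)"
  proof (intro ex1I[of _ g] conjI allI)
    fix h assume h: "clinear h \<and> (\<forall>a b. h (a \<otimes>\<^sub>C b) = f a b)"
    show "h = g"
      by (rule ext, rule tensor_eq) (use h \<open>clinear g\<close> \<open>\<And>a b. g (a \<otimes>\<^sub>C b) = f a b\<close> in simp_all)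
  qed
  from theI'[OF this] show "clinear (tensor_lift f)" "tensor_lift f (a \<otimes>\<^sub>C b) = f a b"
    unfolding tensor_lift_def by auto
qed

lemma clinear_tensor_lift_param:
  assumes "\<And>x. cbilinear (f x)" and "\<And>a b. clinear (\<lambda>x. f x a b)"
  shows "clinear (\<lambda>x. tensor_lift (f x) t)"
proof (rule clinearI)
  fix x y c
  show "tensor_lift (f (x + y)) t = tensor_lift (f x) t + tensor_lift (f y) t"
    by (rule tensor_eq[OF tensor_lift(1)[OF assms(1)]
          clinear_add[OF tensor_lift(1)[OF assms(1)] tensor_lift(1)[OF assms(1)]]])
      (simp add: tensor_lift(2)[OF assms(1)] clinearD[OF assms(2)])
  have "clinear (\<lambda>t. c *\<^sub>C tensor_lift (f x) t)"
    by (rule clinearI) (simp_all add: clinearD[OF tensor_lift(1)[OF assms(1)]]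
        scaleC_add_right scaleC_scaleC mult.commute)
  then show "tensor_lift (f (c *\<^sub>C x)) t = c *\<^sub>C tensor_lift (f x) t"
    by (rule tensor_eq[OF tensor_lift(1)[OF assms(1)]])
      (simp add: tensor_lift(2)[OF assms(1)] clinearD[OF assms(2)])
qed

instantiation tensor :: (complex_comm_algebra, complex_comm_algebra) complex_comm_algebra
begin

definition one_tensor :: "('a, 'b) tensor"
  where "one_tensor = 1 \<otimes>\<^sub>C 1"

definition times_tensor :: "('a, 'b) tensor \<Rightarrow> ('a, 'b) tensor \<Rightarrow> ('a, 'b) tensor"
  where "times_tensor s t =
    tensor_lift (\<lambda>a b. tensor_lift (\<lambda>a' b'. (a * a') \<otimes>\<^sub>C (b * b')) t) s"

instance
proof
  note bil = cbilinearD[OF cbilinear_tensor_elem]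
  have id: "clinear (\<lambda>x::'x::complex_vector. x)"
    by (rule clinearI) auto
  have b1: "cbilinear (\<lambda>a' b'. (a * a') \<otimes>\<^sub>C (b * b'))" for a :: 'a and b :: 'b
    unfolding cbilinear_def
    by (auto intro!: clinear_compose[OF _ bil(1)] clinear_compose[OF _ bil(2)]
        clinear_mult_left id)
  have b2: "cbilinear (\<lambda>a b. tensor_lift (\<lambda>a' b'. (a * a') \<otimes>\<^sub>C (b * b')) t)"
    for t :: "('a, 'b) tensor"
    unfolding cbilinear_def
    by (auto intro!: clinear_tensor_lift_param b1 clinear_compose[OF _ bil(1)]
        clinear_compose[OF _ bil(2)] clinear_mult_right id)
  have m1: "clinear (\<lambda>s. s * t)" for t :: "('a, 'b) tensor"
    unfolding times_tensor_def by (rule tensor_lift(1)[OF b2])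
  have m2: "clinear (\<lambda>t. s * t)" for s :: "('a, 'b) tensor"
  proof -
    have *: "clinear (\<lambda>t. (a \<otimes>\<^sub>C b) * t)" for a :: 'a and b :: 'b
      unfolding times_tensor_def tensor_lift(2)[OF b2] by (rule tensor_lift(1)[OF b1])
    have "s * (t + t') = s * t + s * t'" for t t' :: "('a, 'b) tensor"
      by (rule tensor_eq[OF m1 clinear_add[OF m1 m1]]) (simp add: clinearD[OF *])
    moreover have "s * (c *\<^sub>C t) = c *\<^sub>C (s * t)" for c and t :: "('a, 'b) tensor"
    proof (rule tensor_eq[OF m1])
      show "clinear (\<lambda>s. c *\<^sub>C (s * t))"
        by (rule clinearI) (simp_all add: clinearD[OF m1] scaleC_add_right scaleC_scaleC
            mult.commute)
    qed (simp add: clinearD[OF *])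
    ultimately show ?thesis by (rule clinearI)
  qed
  have mult: "(a \<otimes>\<^sub>C b) * (a' \<otimes>\<^sub>C b') = (a * a') \<otimes>\<^sub>C (b * b')" for a a' :: 'a and b b' :: 'b
    unfolding times_tensor_def tensor_lift(2)[OF b2] by (rule tensor_lift(2)[OF b1])
  fix x y z :: "('a, 'b) tensor" and c :: complex
  show "x * y * z = x * (y * z)"
  proof (rule tensor_eq[OF clinear_compose[OF m1 m1] m1])
    fix a b
    show "(a \<otimes>\<^sub>C b) * y * z = (a \<otimes>\<^sub>C b) * (y * z)"
    proof (rule tensor_eq[OF clinear_compose[OF m2 m1] clinear_compose[OF m1 m2]])
      fix a' b'
      show "(a \<otimes>\<^sub>C b) * (a' \<otimes>\<^sub>C b') * z = (a \<otimes>\<^sub>C b) * ((a' \<otimes>\<^sub>C b') * z)"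
        by (rule tensor_eq[OF m2 clinear_compose[OF m2 m2]]) (simp add: mult mult.assoc)
    qed
  qed
  show "x * y = y * x"
  proof (rule tensor_eq[OF m1 m2])
    fix a b
    show "(a \<otimes>\<^sub>C b) * y = y * (a \<otimes>\<^sub>C b)"
      by (rule tensor_eq[OF m2 m1]) (simp add: mult mult.commute)
  qed
  show "1 * x = x"
    unfolding one_tensor_def by (rule tensor_eq[OF m2 id]) (simp add: mult)
  show "(x + y) * z = x * z + y * z" "(c *\<^sub>C x) * y = c *\<^sub>C (x * y)"
    by (simp_all add: clinearD[OF m1])
  obtain f :: "'a \<Rightarrow> complex" where f: "clinear f" "f 1 = 1"
    by (rule clinear_functional[of "1::'a"]) auto
  obtain g :: "'b \<Rightarrow> complex" where g: "clinear g" "g 1 = 1"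
    by (rule clinear_functional[of "1::'b"]) auto
  have fg: "cbilinear (\<lambda>a b. f a * g b)"
    unfolding cbilinear_def by (intro conjI allI clinear_mult_left clinear_mult_right f g)
  have "tensor_lift (\<lambda>a b. f a * g b) 1 = 1"
    unfolding one_tensor_def tensor_lift(2)[OF fg] by (simp add: f g)
  then show "(0::('a, 'b) tensor) \<noteq> 1"
    using clinearD(3)[OF tensor_lift(1)[OF fg]] by auto
qed

end

lemma tensor_mult: "(a \<otimes>\<^sub>C b) * (a' \<otimes>\<^sub>C b') = (a * a') \<otimes>\<^sub>C (b * b')"
  for a a' :: "'a::complex_comm_algebra" and b b' :: "'b::complex_comm_algebra"
proof -
  note bil = cbilinearD[OF cbilinear_tensor_elem]
  have id: "clinear (\<lambda>x::'x::complex_vector. x)"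
    by (rule clinearI) auto
  have b1: "cbilinear (\<lambda>a' b'. (a * a') \<otimes>\<^sub>C (b * b'))" for a :: 'a and b :: 'b
    unfolding cbilinear_def
    by (auto intro!: clinear_compose[OF _ bil(1)] clinear_compose[OF _ bil(2)]
        clinear_mult_left id)
  have b2: "cbilinear (\<lambda>a b. tensor_lift (\<lambda>a' b'. (a * a') \<otimes>\<^sub>C (b * b')) t)"
    for t :: "('a, 'b) tensor"
    unfolding cbilinear_def
    by (auto intro!: clinear_tensor_lift_param b1 clinear_compose[OF _ bil(1)]
        clinear_compose[OF _ bil(2)] clinear_mult_right id)
  show ?thesis
    unfolding times_tensor_def tensor_lift(2)[OF b2] by (rule tensor_lift(2)[OF b1])
qed


section \<open>Symmetric algebras\<close>

text \<open>The type \<open>'v multiset \<Rightarrow>\<^sub>0 complex\<close> with its convolution product is the commutative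
  polynomial algebra with one variable for each vector in \<open>'v\<close>.  The symmetric algebra on \<open>'v\<close>
  is its quotient by the ideal generated by the linear relations between these variables.\<close>

lemma module_mult: "module ((*) :: 'a::comm_ring_1 \<Rightarrow> 'a \<Rightarrow> 'a)"
  by unfold_locales (simp_all add: distrib_left distrib_right mult.assoc)

definition sym_relators :: "('v::complex_vector multiset \<Rightarrow>\<^sub>0 complex) set"
  where "sym_relators =
    {Poly_Mapping.single {#u + v#} 1 - Poly_Mapping.single {#u#} 1
       - Poly_Mapping.single {#v#} 1 | u v. True} \<union>
    {Poly_Mapping.single {#c *\<^sub>C v#} 1 - c *\<^sub>C Poly_Mapping.single {#v#} 1 | c v. True}"

definition sym_rel ::
    "('v::complex_vector multiset \<Rightarrow>\<^sub>0 complex) \<Rightarrow> ('v multiset \<Rightarrow>\<^sub>0 complex) \<Rightarrow> bool"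
  where "sym_rel p q \<longleftrightarrow> p - q \<in> module.span (*) sym_relators"

lemma equivp_sym_rel: "equivp sym_rel"
proof (rule equivpI)
  show "reflp sym_rel"
    by (simp add: reflp_def sym_rel_def module.span_zero[OF module_mult])
  show "symp sym_rel"
    unfolding symp_def sym_rel_def by (clarify, drule module.span_neg[OF module_mult]) simp
  show "transp sym_rel"
    unfolding transp_def sym_rel_def by (clarify, drule (1) module.span_add[OF module_mult]) simp
qed

quotient_type (overloaded) 'v sym_alg =
    "'v::complex_vector multiset \<Rightarrow>\<^sub>0 complex" / sym_rel
  by (rule equivp_sym_rel)

lift_definition sym_gen :: "'v::complex_vector \<Rightarrow> 'v sym_alg"
  is "\<lambda>v. Poly_Mapping.single {#v#} 1" .

instantiation sym_alg :: (complex_vector) complex_comm_algebra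
begin
lift_definition zero_sym_alg :: "'a sym_alg" is 0 .
lift_definition one_sym_alg :: "'a sym_alg" is 1 .
lift_definition plus_sym_alg :: "'a sym_alg \<Rightarrow> 'a sym_alg \<Rightarrow> 'a sym_alg" is "(+)"
  unfolding sym_rel_def by (drule (1) module.span_add[OF module_mult]) (simp add: algebra_simps)
lift_definition minus_sym_alg :: "'a sym_alg \<Rightarrow> 'a sym_alg \<Rightarrow> 'a sym_alg" is "(-)"
  unfolding sym_rel_def by (drule (1) module.span_diff[OF module_mult]) (simp add: algebra_simps)
lift_definition uminus_sym_alg :: "'a sym_alg \<Rightarrow> 'a sym_alg" is uminus
  unfolding sym_rel_def by (drule module.span_neg[OF module_mult]) (simp add: algebra_simps)
lift_definition times_sym_alg :: "'a sym_alg \<Rightarrow> 'a sym_alg \<Rightarrow> 'a sym_alg" is "(*)"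
proof -
  fix p p' q q' :: "'a multiset \<Rightarrow>\<^sub>0 complex"
  assume "sym_rel p p'" and "sym_rel q q'"
  then have "q * (p - p') + p' * (q - q') \<in> module.span (*) sym_relators"
    unfolding sym_rel_def by (intro module.span_add[OF module_mult] module.span_scale[OF module_mult])
  then show "sym_rel (p * q) (p' * q')"
    unfolding sym_rel_def by (simp add: algebra_simps)
qed
lift_definition scaleC_sym_alg :: "complex \<Rightarrow> 'a sym_alg \<Rightarrow> 'a sym_alg" is scaleC
  unfolding sym_rel_def
  by (simp flip: cvs.scale_right_diff_distrib)
    (simp add: poly_mapping_scaleC_mult(1) module.span_scale[OF module_mult])
instance
proof
  have eq: "p = q \<Longrightarrow> sym_rel p q" for p q :: "'a multiset \<Rightarrow>\<^sub>0 complex"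
    by (simp add: equivp_reflp[OF equivp_sym_rel])
  fix x y z :: "'a sym_alg" and c d :: complex
  show "x + y + z = x + (y + z)" by transfer (rule eq, simp add: add.assoc)
  show "x + y = y + x" by transfer (rule eq, simp add: add.commute)
  show "0 + x = x" by transfer (rule eq, simp)
  show "- x + x = 0" by transfer (rule eq, simp)
  show "x - y = x + - y" by transfer (rule eq, simp)
  show "c *\<^sub>C (x + y) = c *\<^sub>C x + c *\<^sub>C y" by transfer (rule eq, simp add: scaleC_add_right)
  show "(c + d) *\<^sub>C x = c *\<^sub>C x + d *\<^sub>C x" by transfer (rule eq, simp add: scaleC_add_left)
  show "c *\<^sub>C d *\<^sub>C x = (c * d) *\<^sub>C x" by transfer (rule eq, simp add: scaleC_scaleC)
  show "1 *\<^sub>C x = x" by transfer (rule eq, simp add: scaleC_one)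
  show "x * y * z = x * (y * z)" by transfer (rule eq, simp add: mult.assoc)
  show "x * y = y * x" by transfer (rule eq, simp add: mult.commute)
  show "1 * x = x" by transfer (rule eq, simp)
  show "(x + y) * z = x * z + y * z" by transfer (rule eq, simp add: distrib_right)
  show "(c *\<^sub>C x) * y = c *\<^sub>C (x * y)" by transfer (rule eq, rule poly_mapping_scaleC_mult)
  have "Poly_Mapping.lookup p {#} = 0" if "p \<in> module.span (*) sym_relators"
    for p :: "'a multiset \<Rightarrow>\<^sub>0 complex"
    using that
  proof (induction rule: module.span_induct_alt[OF module_mult, consumes 1, case_names base step])
    case (step r x y)
    let ?F = "free_lift (\<lambda>M. if M = {#} then 1 else 0 :: complex)"
    have lookup: "Poly_Mapping.lookup q {#} = ?F q" for q :: "'a multiset \<Rightarrow>\<^sub>0 complex"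
      by (cases "{#} \<in> Poly_Mapping.keys q")
        (simp_all add: free_lift_def scaleC_complex_def if_distrib sum.If_cases in_keys_iff)
    have lin: "clinear (\<lambda>r. ?F (r * x))"
      by (rule clinearI) (simp_all add: poly_mapping_scaleC_mult(2) distrib_right
          clinearD[OF clinear_free_lift])
    have "?F (r * x) = 0"
    proof (rule free_space_eq[OF lin])
      fix M :: "'a multiset"
      show "?F (Poly_Mapping.single M 1 * x) = 0"
        using step(1)
        by (auto simp: sym_relators_def right_diff_distrib mult_single
            clinearD[OF clinear_free_lift] scaleC_complex_def)
    next
      show "clinear (\<lambda>r::'a multiset \<Rightarrow>\<^sub>0 complex. 0::complex)" by (rule clinearI) simp_all
    qed
    then show ?case
      using step by (simp add: lookup clinearD[OF clinear_free_lift])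
  qed simp
  from this[of "0 - 1"] show "(0::'a sym_alg) \<noteq> 1"
    by transfer (auto simp: sym_rel_def)
qed
end

lemma clinear_abs_sym: "clinear abs_sym_alg"
  by (rule clinearI) (simp_all add: plus_sym_alg.abs_eq scaleC_sym_alg.abs_eq)

lemma abs_sym_eq_0: "p \<in> sym_relators \<Longrightarrow> abs_sym_alg p = 0"
  by (simp add: zero_sym_alg_def sym_alg.abs_eq_iff sym_rel_def module.span_base[OF module_mult])

lemma clinear_sym_gen: "clinear sym_gen"
proof -
  have rel: "abs_sym_alg p = abs_sym_alg q" if "p - q \<in> sym_relators"
    for p q :: "'a multiset \<Rightarrow>\<^sub>0 complex"
    using abs_sym_eq_0[OF that] by (simp add: clinearD[OF clinear_abs_sym])
  note [simp del] = scaleC_single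
  show ?thesis
  proof (rule clinearI)
    fix u v :: 'a and c
    show "sym_gen (u + v) = sym_gen u + sym_gen v"
      unfolding sym_gen.abs_eq clinearD(1)[OF clinear_abs_sym, symmetric]
      by (rule rel) (unfold sym_relators_def diff_diff_eq[symmetric], blast)
    show "sym_gen (c *\<^sub>C u) = c *\<^sub>C sym_gen u"
      unfolding sym_gen.abs_eq clinearD(2)[OF clinear_abs_sym, symmetric]
      by (rule rel) (unfold sym_relators_def, blast)
  qed
qed

lemma abs_sym_single:
  "abs_sym_alg (Poly_Mapping.single M 1) = (\<Prod>v\<in>#M. sym_gen v)"
proof (induction M)
  case empty
  show ?case by (simp add: one_sym_alg.abs_eq)
next
  case (add v M)
  have "Poly_Mapping.single (add_mset v M) 1
      = Poly_Mapping.single {#v#} 1 * Poly_Mapping.single M (1::complex)"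
    by (simp add: mult_single)
  with add show ?case
    by (simp add: times_sym_alg.abs_eq[symmetric] sym_gen.abs_eq)
qed

lemma sym_alg_eq:
  assumes g: "clinear g" and h: "clinear h"
    and eq: "\<And>M. g (\<Prod>v\<in>#M. sym_gen v) = h (\<Prod>v\<in>#M. sym_gen v)"
  shows "g x = h x"
proof (induct x rule: sym_alg.abs_induct)
  case (1 p)
  show ?case
    by (rule free_space_eq[OF clinear_compose[OF clinear_abs_sym g]
          clinear_compose[OF clinear_abs_sym h]])
      (simp add: abs_sym_single eq)
qed

text \<open>A linear map on polynomials that kills the ideal of linear relations factors through the
  symmetric algebra.\<close>

lemma sym_alg_factor:
  assumes F: "clinear F"
    and F0: "\<And>M x. x \<in> sym_relators \<Longrightarrow> F (Poly_Mapping.single M 1 * x) = 0"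
  obtains g where "clinear g" "\<And>M. g (\<Prod>v\<in>#M. sym_gen v) = F (Poly_Mapping.single M 1)"
proof
  have F0': "F p = 0" if "p \<in> module.span (*) sym_relators" for p
    using that
  proof (induction rule: module.span_induct_alt[OF module_mult, consumes 1, case_names base step])
    case base show ?case by (simp add: clinearD[OF F])
  next
    case (step r x y)
    have lin: "clinear (\<lambda>r. F (r * x))"
      by (rule clinearI) (simp_all add: poly_mapping_scaleC_mult(2) distrib_right clinearD[OF F])
    have "F (r * x) = 0"
    proof (rule free_space_eq[OF lin])
      show "clinear (\<lambda>r::'a multiset \<Rightarrow>\<^sub>0 complex. 0::'b)" by (rule clinearI) simp_all
    qed (rule F0[OF step(1)])
    with step show ?case by (simp add: clinearD[OF F])
  qed
  have Feq: "F p = F q" if "abs_sym_alg p = abs_sym_alg q" for p q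
    using F0'[of "p - q"] that
    by (simp add: sym_alg.abs_eq_iff sym_rel_def clinearD[OF F])
  define g where "g t = F (rep_sym_alg t)" for t
  have g_abs: "g (abs_sym_alg p) = F p" for p
    unfolding g_def by (rule Feq) (metis Quotient3_sym_alg Quotient3_abs_rep)
  show "g (\<Prod>v\<in>#M. sym_gen v) = F (Poly_Mapping.single M 1)" for M
    by (simp add: abs_sym_single[symmetric] g_abs)
  show "clinear g"
  proof (rule clinearI)
    fix x y :: "'a sym_alg" and c
    have "\<exists>p. z = abs_sym_alg p" for z :: "'a sym_alg"
      by (induct z rule: sym_alg.abs_induct) auto
    then obtain p q where x: "x = abs_sym_alg p" and y: "y = abs_sym_alg q"
      by blast
    show "g (x + y) = g x + g y" "g (c *\<^sub>C x) = c *\<^sub>C g x"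
      unfolding x y clinearD[OF clinear_abs_sym, symmetric] g_abs
      by (simp_all add: clinearD[OF F])
  qed
qed

definition sym_lift ::
    "('v::complex_vector \<Rightarrow> 'a::complex_comm_algebra) \<Rightarrow> 'v sym_alg \<Rightarrow> 'a"
  where "sym_lift f = (THE g. alg_hom g \<and> (\<forall>v. g (sym_gen v) = f v))"

lemma sym_lift:
  assumes f: "clinear f"
  shows "alg_hom (sym_lift f)" "sym_lift f (sym_gen v) = f v"
proof -
  let ?F = "free_lift (\<lambda>M. \<Prod>v\<in>#M. f v)"
  have "?F (Poly_Mapping.single M 1 * x) = 0" if "x \<in> sym_relators" for M x
    using that
    by (auto simp: sym_relators_def right_diff_distrib mult_single clinearD[OF f]
        clinearD[OF clinear_free_lift] scaleC_complex_def scaleC_one scaleC_mult_left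
        scaleC_mult_right distrib_right)
  from sym_alg_factor[OF clinear_free_lift this] obtain g
    where g: "clinear g" "\<And>M. g (\<Prod>v\<in>#M. sym_gen v) = (\<Prod>v\<in>#M. f v)"
    by (auto simp: scaleC_one)
  have "g (x * y) = g x * g y" for x y
  proof (rule sym_alg_eq[where x = x])
    fix M
    show "g ((\<Prod>v\<in>#M. sym_gen v) * y) = g (\<Prod>v\<in>#M. sym_gen v) * g y"
    proof (rule sym_alg_eq[where x = y])
      fix N
      show "g ((\<Prod>v\<in>#M. sym_gen v) * (\<Prod>v\<in>#N. sym_gen v))
        = g (\<Prod>v\<in>#M. sym_gen v) * g (\<Prod>v\<in>#N. sym_gen v)"
        using g(2)[of "M + N"] by (simp add: g(2))
    next
      show "clinear (\<lambda>y. g ((\<Prod>v\<in>#M. sym_gen v) * y))"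
        by (rule clinearI) (simp_all add: clinearD[OF g(1)] distrib_left scaleC_mult_right)
    qed (rule clinear_mult_left[OF g(1)])
  next
    show "clinear (\<lambda>x. g (x * y))"
      by (rule clinearI) (simp_all add: clinearD[OF g(1)] distrib_right scaleC_mult_left)
  qed (rule clinear_mult_right[OF g(1)])
  then have "alg_hom g" "\<And>v. g (sym_gen v) = f v"
    using g(1) g(2)[of "{#}"] g(2)[of "{#v#}" for v] by (auto simp: alg_hom_def)
  moreover have "h = g" if h: "alg_hom h" "\<And>v. h (sym_gen v) = f v" for h
  proof (rule ext, rule sym_alg_eq)
    show "h (\<Prod>v\<in>#M. sym_gen v) = g (\<Prod>v\<in>#M. sym_gen v)" for M
      unfolding g(2) using h by (induction M) (simp_all add: alg_hom_def)
  qed (use h g in \<open>simp_all add: alg_hom_def\<close>)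
  ultimately have "\<exists>!g. alg_hom g \<and> (\<forall>v. g (sym_gen v) = f v)"
    by (intro ex1I[of _ g]) blast+
  from theI'[OF this] show "alg_hom (sym_lift f)" "sym_lift f (sym_gen v) = f v"
    unfolding sym_lift_def by auto
qed

lemma ex1_sym_derivation:
  fixes f :: "'v::complex_vector \<Rightarrow> 'v sym_alg"
  assumes f: "clinear f"
  shows "\<exists>!D. derivation D \<and> (\<forall>v. D (sym_gen v) = f v)"
proof -
  define m :: "'v multiset \<Rightarrow> 'v sym_alg" where "m M = (\<Prod>v\<in>#M. sym_gen v)" for M
  define d where "d M = (\<Sum>v\<in>#M. m (M - {#v#}) * f v)" for M
  have m_simps: "m {#} = 1" "m {#v#} = sym_gen v" "m (add_mset v M) = sym_gen v * m M"
    "m (M + N) = m M * m N" for v M N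
    by (simp_all add: m_def)
  have d1: "(\<Sum>v\<in>#M. m (M + N - {#v#}) * f v) = d M * m N" for M N
  proof -
    have "m (M + N - {#v#}) * f v = (m (M - {#v#}) * f v) * m N" if "v \<in># M" for v
    proof -
      from that obtain M' where "M = add_mset v M'" by (blast dest: multi_member_split)
      then show ?thesis by (simp add: m_simps mult_ac)
    qed
    then have "(\<Sum>v\<in>#M. m (M + N - {#v#}) * f v) = (\<Sum>v\<in>#M. (m (M - {#v#}) * f v) * m N)"
      by (intro arg_cong[of _ _ sum_mset] image_mset_cong)
    then show ?thesis by (simp add: d_def sum_mset_distrib_right)
  qed
  have d_add: "d (M + N) = d M * m N + m M * d N" for M N
    using d1[of M N] d1[of N M]
    by (simp add: d_def[of "M + N"] add.commute[of N M] mult.commute)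
  have d_simps: "d {#} = 0" "d {#v#} = f v" "d (add_mset v M) = f v * m M + sym_gen v * d M" for v M
  proof -
    show "d {#} = 0" and dv: "d {#v#} = f v" by (simp_all add: d_def m_simps)
    show "d (add_mset v M) = f v * m M + sym_gen v * d M"
      using d_add[of "{#v#}" M] by (simp add: dv m_simps)
  qed
  have "free_lift d (Poly_Mapping.single M 1 * x) = 0" if "x \<in> sym_relators" for M x
    using that
    by (auto simp: sym_relators_def right_diff_distrib mult_single clinearD[OF f] d_simps
        clinearD[OF clinear_free_lift] clinearD[OF clinear_sym_gen] scaleC_complex_def scaleC_one
        scaleC_mult_left scaleC_mult_right scaleC_add_right distrib_right)
  from sym_alg_factor[OF clinear_free_lift this] obtain D
    where D: "clinear D" "\<And>M. D (m M) = d M"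
    by (auto simp: scaleC_one m_def)
  have "D (x * y) = D x * y + x * D y" for x y
  proof (rule sym_alg_eq[where x = x], unfold m_def[symmetric])
    fix M
    show "D (m M * y) = D (m M) * y + m M * D y"
    proof (rule sym_alg_eq[where x = y], unfold m_def[symmetric])
      fix N
      show "D (m M * m N) = D (m M) * m N + m M * D (m N)"
        using D(2)[of "M + N"] by (simp add: m_simps D(2) d_add)
    qed (rule clinearI; simp add: clinearD[OF D(1)] distrib_left scaleC_mult_right
        scaleC_add_right)+
  qed (rule clinearI; simp add: clinearD[OF D(1)] distrib_right scaleC_mult_left
      scaleC_add_right)+
  then have "derivation D" "\<And>v. D (sym_gen v) = f v"
    using D(1) D(2)[of "{#v#}" for v] by (auto simp: derivation_def m_simps d_simps)
  moreover have "E = D" if E: "derivation E" "\<And>v. E (sym_gen v) = f v" for E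
  proof -
    have "E (1 * 1) = E 1 * 1 + 1 * E 1"
      using E(1) unfolding derivation_def by blast
    then have "E 1 = 0" by simp
    then have eq: "E (m M) = D (m M)" for M
      unfolding D(2) using E by (induction M) (simp_all add: derivation_def m_simps d_simps)
    have "clinear E" using E(1) by (simp add: derivation_def)
    from sym_alg_eq[OF this D(1) eq[unfolded m_def]] show "E = D" by blast
  qed
  ultimately show ?thesis
    by (intro ex1I[of _ D]) blast+
qed


section \<open>Nonlocal vertex algebras\<close>

text \<open>A formal series \<open>\<Sum>\<^sub>n a\<^sub>n x\<^sup>n\<close> in \<open>V[[x,x\<^sup>-\<^sup>1]]\<close> is the function \<open>n \<mapsto> a\<^sub>n\<close>, so for a
  vertex operator map \<open>Y\<close> the term \<open>Y u v n\<close> denotes the coefficient of \<open>x\<^sup>n\<close> in \<open>Y(u,x)v\<close>.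
  In terms of modes, \<open>Y u v n = u\<^sub>-\<^sub>n\<^sub>-\<^sub>1 v\<close>.\<close>

type_synonym 'v series = "int \<Rightarrow> 'v"

definition clinear_on :: "'a::complex_vector set \<Rightarrow> ('a \<Rightarrow> 'b::complex_vector) \<Rightarrow> bool"
  where "clinear_on V f \<longleftrightarrow>
    (\<forall>x\<in>V. \<forall>y\<in>V. f (x + y) = f x + f y) \<and> (\<forall>c. \<forall>x\<in>V. f (c *\<^sub>C x) = c *\<^sub>C f x)"

text \<open>\<open>Y\<close> is a linear map from \<open>V\<close> to \<open>Hom(W, W((x)))\<close>.\<close>

definition vertex_operator_map ::
    "'v::complex_vector set \<Rightarrow> 'w::complex_vector set \<Rightarrow> ('v \<Rightarrow> 'w \<Rightarrow> 'w series) \<Rightarrow> bool"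
  where "vertex_operator_map V W Y \<longleftrightarrow>
    (\<forall>u\<in>V. \<forall>w\<in>W. \<forall>n. Y u w n \<in> W) \<and>
    (\<forall>u\<in>V. \<forall>w\<in>W. \<exists>N. \<forall>n<N. Y u w n = 0) \<and>
    (\<forall>u\<in>V. \<forall>n. clinear_on W (\<lambda>w. Y u w n)) \<and>
    (\<forall>w\<in>W. \<forall>n. clinear_on V (\<lambda>u. Y u w n))"

text \<open>The coefficient of \<open>x\<^sub>0\<^sup>p x\<^sub>2\<^sup>q\<close> on the two sides of
  \<open>(x\<^sub>0 + x\<^sub>2)\<^sup>l Y\<^sub>W(u, x\<^sub>0 + x\<^sub>2) Y\<^sub>W(v, x\<^sub>2) w = (x\<^sub>0 + x\<^sub>2)\<^sup>l Y\<^sub>W(Y(u, x\<^sub>0)v, x\<^sub>2) w\<close>.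
  On the left, the coefficient \<open>Y\<^sub>W u _ m\<close> comes with \<open>(x\<^sub>0 + x\<^sub>2)\<^sup>m\<^sup>+\<^sup>l\<close>, expanded in nonnegative
  powers of \<open>x\<^sub>2\<close>; the term \<open>x\<^sub>0\<^sup>p x\<^sub>2\<^sup>j\<close> of this expansion occurs for \<open>m = p + j - l\<close>.  Only
  finitely many \<open>j\<close> contribute, since \<open>Y\<^sub>W(v, x\<^sub>2) w\<close> is truncated from below.\<close>

definition weak_associativity ::
    "('v::complex_vector \<Rightarrow> 'v \<Rightarrow> 'v series) \<Rightarrow> ('v \<Rightarrow> 'w::complex_vector \<Rightarrow> 'w series) \<Rightarrow>
      'v \<Rightarrow> 'v \<Rightarrow> 'w \<Rightarrow> bool"
  where "weak_associativity Y YW u v w \<longleftrightarrow> (\<exists>l::nat. \<forall>p q.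
    Sum_any (\<lambda>j::nat. (of_int (p + int j) gchoose j) *\<^sub>C
        YW u (YW v w (q - int j)) (p + int j - int l))
    = (\<Sum>i\<le>l. of_nat (l choose i) *\<^sub>C YW (Y u v (p - int (l - i))) w (q - int i)))"

definition nonlocal_vertex_algebra ::
    "'v::complex_vector set \<Rightarrow> ('v \<Rightarrow> 'v \<Rightarrow> 'v series) \<Rightarrow> 'v \<Rightarrow> bool"
  where "nonlocal_vertex_algebra V Y vac \<longleftrightarrow>
    cvs.subspace V \<and> vac \<in> V \<and> vertex_operator_map V V Y \<and>
    (\<forall>v\<in>V. \<forall>n. Y vac v n = (if n = 0 then v else 0)) \<and>
    (\<forall>v\<in>V. (\<forall>n<0. Y v vac n = 0) \<and> Y v vac 0 = v) \<and>
    (\<forall>u\<in>V. \<forall>v\<in>V. \<forall>w\<in>V. weak_associativity Y Y u v w)"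

text \<open>The coefficients of \<open>x\<^sub>1\<^sup>p x\<^sub>2\<^sup>q\<close> in \<open>(x\<^sub>1 - x\<^sub>2)\<^sup>k [Y(u, x\<^sub>1), Y(v, x\<^sub>2)] w\<close> vanish for all
  \<open>w\<close>, with \<open>k\<close> independent of \<open>w\<close>.\<close>

definition locality ::
    "'v::complex_vector set \<Rightarrow> ('v \<Rightarrow> 'v \<Rightarrow> 'v series) \<Rightarrow> 'v \<Rightarrow> 'v \<Rightarrow> bool"
  where "locality V Y u v \<longleftrightarrow> (\<exists>k::nat. \<forall>w\<in>V. \<forall>p q.
    (\<Sum>i\<le>k. ((- 1) ^ i * of_nat (k choose i)) *\<^sub>C
      (Y u (Y v w (q - int i)) (p - int (k - i)) - Y v (Y u w (p - int (k - i))) (q - int i)))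
    = 0)"

definition vertex_algebra ::
    "'v::complex_vector set \<Rightarrow> ('v \<Rightarrow> 'v \<Rightarrow> 'v series) \<Rightarrow> 'v \<Rightarrow> bool"
  where "vertex_algebra V Y vac \<longleftrightarrow>
    nonlocal_vertex_algebra V Y vac \<and> (\<forall>u\<in>V. \<forall>v\<in>V. locality V Y u v)"

definition va_module ::
    "'v::complex_vector set \<Rightarrow> ('v \<Rightarrow> 'v \<Rightarrow> 'v series) \<Rightarrow> 'v \<Rightarrow>
      'w::complex_vector set \<Rightarrow> ('v \<Rightarrow> 'w \<Rightarrow> 'w series) \<Rightarrow> bool"
  where "va_module V Y vac W YW \<longleftrightarrow>
    cvs.subspace W \<and> vertex_operator_map V W YW \<and>
    (\<forall>w\<in>W. \<forall>n. YW vac w n = (if n = 0 then w else 0)) \<and>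
    (\<forall>u\<in>V. \<forall>v\<in>V. \<forall>w\<in>W. weak_associativity Y YW u v w)"

text \<open>The ambient structure \<open>(V, Y, vac)\<close> need only be nonlocal; the subspace \<open>U\<close> contains the
  vacuum, is closed under all coefficients of \<open>Y\<close> (both part of \<open>vertex_algebra U Y vac\<close>),
  and is an ordinary vertex algebra under the restricted operations.\<close>

definition vertex_subalgebra ::
    "'v::complex_vector set \<Rightarrow> 'v set \<Rightarrow> ('v \<Rightarrow> 'v \<Rightarrow> 'v series) \<Rightarrow> 'v \<Rightarrow> bool"
  where "vertex_subalgebra U V Y vac \<longleftrightarrow> U \<subseteq> V \<and> vertex_algebra U Y vac"

definition va_isomorphism ::
    "'v::complex_vector set \<Rightarrow> ('v \<Rightarrow> 'v \<Rightarrow> 'v series) \<Rightarrow> 'v \<Rightarrow>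
      'w::complex_vector set \<Rightarrow> ('w \<Rightarrow> 'w \<Rightarrow> 'w series) \<Rightarrow> 'w \<Rightarrow> ('v \<Rightarrow> 'w) \<Rightarrow> bool"
  where "va_isomorphism V Y vac V' Y' vac' \<phi> \<longleftrightarrow>
    bij_betw \<phi> V V' \<and> clinear_on V \<phi> \<and> \<phi> vac = vac' \<and>
    (\<forall>u\<in>V. \<forall>v\<in>V. \<forall>n. \<phi> (Y u v n) = Y' (\<phi> u) (\<phi> v) n)"

text \<open>The vertex operator map
  \<open>Y\<^sup>\<sharp>(u \<otimes> h, x)(v \<otimes> k) = \<Sum> Y\<^sub>V(u, x) Y\<^sub>M(h\<^sub>(\<^sub>1\<^sub>), x)v \<otimes> Y\<^sub>H(h\<^sub>(\<^sub>2\<^sub>), x)k\<close> of the smash product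
  \<open>V \<sharp> H\<close>, with \<open>cop\<close> the comultiplication of \<open>H\<close>.  The three factors contribute the powers
  \<open>i\<close>, \<open>j\<close> and \<open>n - i - j\<close> of \<open>x\<close>.\<close>

definition smash_Y ::
    "('v::complex_vector \<Rightarrow> 'v \<Rightarrow> 'v series) \<Rightarrow> ('h::complex_vector \<Rightarrow> 'h \<Rightarrow> 'h series) \<Rightarrow>
      ('h \<Rightarrow> ('h, 'h) tensor) \<Rightarrow> ('h \<Rightarrow> 'v \<Rightarrow> 'v series) \<Rightarrow>
      ('v, 'h) tensor \<Rightarrow> ('v, 'h) tensor \<Rightarrow> ('v, 'h) tensor series"
  where "smash_Y YV YH cop YM s t n =
    tensor_lift (\<lambda>u h. tensor_lift (\<lambda>v k. tensor_lift (\<lambda>h1 h2.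
        Sum_any (\<lambda>(i, j). YV u (YM h1 v j) i \<otimes>\<^sub>C YH h2 k (n - i - j))) (cop h)) t) s"


section \<open>The Heisenberg data\<close>

text \<open>The space \<open>h \<otimes> t\<^sup>-\<^sup>1\<complex>[t\<^sup>-\<^sup>1] = \<Oplus>\<^sub>n\<^sub>\<ge>\<^sub>1 h \<otimes> t\<^sup>-\<^sup>n\<close> is \<open>nat \<Rightarrow>\<^sub>0 'h\<close>, where index \<open>n - 1\<close>
  carries the summand \<open>h \<otimes> t\<^sup>-\<^sup>n\<close>.\<close>

type_synonym 'h heis = "(nat \<Rightarrow>\<^sub>0 'h) sym_alg"

text \<open>\<open>heis_gen a n\<close> is the generator \<open>a(-n)\<close> and is meaningful only for \<open>n \<ge> 1\<close>.\<close>

definition heis_gen :: "'h::complex_vector \<Rightarrow> nat \<Rightarrow> 'h heis"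
  where "heis_gen a n = sym_gen (Poly_Mapping.single (n - 1) a)"

definition heis_Delta :: "'h::complex_vector heis \<Rightarrow> ('h heis, 'h heis) tensor"
  where "heis_Delta = sym_lift (\<lambda>a. sym_gen a \<otimes>\<^sub>C 1 + 1 \<otimes>\<^sub>C sym_gen a)"

text \<open>Here and in \<open>heis_op\<close> the derivation exists and is unique by \<open>ex1_sym_derivation\<close>: its values
  on the generators extend linearly to \<open>nat \<Rightarrow>\<^sub>0 'h\<close>.\<close>

definition heis_L :: "'h::complex_vector heis \<Rightarrow> 'h heis"
  where "heis_L = (THE D. derivation D \<and>
    (\<forall>a. \<forall>n\<ge>1. D (heis_gen a n) = of_nat n *\<^sub>C heis_gen a (n + 1)))"

text \<open>\<open>Y(a, x)b = (e\<^sup>x\<^sup>L\<^sup>(\<^sup>-\<^sup>1\<^sup>) a)b\<close>\<close>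

definition heis_Y :: "'h::complex_vector heis \<Rightarrow> 'h heis \<Rightarrow> 'h heis series"
  where "heis_Y a b n =
    (if n \<ge> 0 then (1 / fact (nat n)) *\<^sub>C ((heis_L ^^ nat n) a * b) else 0)"

definition heis_op ::
    "('h::complex_vector \<Rightarrow> 'h \<Rightarrow> complex) \<Rightarrow> 'h \<Rightarrow> int \<Rightarrow> 'h heis \<Rightarrow> 'h heis"
  where "heis_op form \<alpha> n =
    (if n > 0 then (THE D. derivation D \<and> (\<forall>\<beta>. \<forall>m\<ge>1.
        D (heis_gen \<beta> m) = (if int m = n then (of_int n * form \<alpha> \<beta>) *\<^sub>C 1 else 0)))
     else if n = 0 then (\<lambda>_. 0)
     else (\<lambda>v. heis_gen \<alpha> (nat (- n)) * v))"

text \<open>\<open>\<alpha>(x)\<^sup>- v = \<Sum>\<^sub>n\<^sub>\<ge>\<^sub>0 \<alpha>(n)v x\<^sup>-\<^sup>n\<^sup>-\<^sup>1\<close> and \<open>\<alpha>(x)\<^sup>+ v = \<Sum>\<^sub>n\<^sub>\<ge>\<^sub>1 \<alpha>(-n)v x\<^sup>n\<^sup>-\<^sup>1\<close>\<close>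

definition heis_minus ::
    "('h::complex_vector \<Rightarrow> 'h \<Rightarrow> complex) \<Rightarrow> 'h \<Rightarrow> 'h heis \<Rightarrow> 'h heis series"
  where "heis_minus form \<alpha> v k = (if k < 0 then heis_op form \<alpha> (- k - 1) v else 0)"

definition heis_plus ::
    "('h::complex_vector \<Rightarrow> 'h \<Rightarrow> complex) \<Rightarrow> 'h \<Rightarrow> 'h heis \<Rightarrow> 'h heis series"
  where "heis_plus form \<alpha> v k = (if k \<ge> 0 then heis_op form \<alpha> (- k - 1) v else 0)"

end

theory Submission
  imports Defs "HOL-Computational_Algebra.Formal_Laurent_Series"
begin

text \<open>The operators \<open>\<alpha>(n)\<close>, \<open>n \<ge> 0\<close>, are derivations and satisfy
  \<open>\<Delta> \<circ> \<alpha>(n) = (\<alpha>(n) \<otimes> 1) \<circ> \<Delta>\<close>.  Write \<open>E(a, x) = e\<^sup>x\<^sup>L\<^sup>(\<^sup>-\<^sup>1\<^sup>) a\<close>.  Weak associativity, applied to the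
  generators \<open>\<alpha>(-1)\<close>, yields the normally ordered recursion
  \<open>Y\<^sub>M\<^sub>(\<^sub>1\<^sub>)(\<alpha>(-m)u, x)w = E(\<alpha>(-m), x) Y\<^sub>M\<^sub>(\<^sub>1\<^sub>)(u, x)w + Y\<^sub>M\<^sub>(\<^sub>1\<^sub>)(u, x) Y\<^sub>M(\<alpha>(-m), x)w\<close>
  and the multiplicativity \<open>Y\<^sub>M(\<alpha>(-m)h, x) = Y\<^sub>M(h, x) Y\<^sub>M(\<alpha>(-m), x)\<close>.  By the latter,
  \<open>Y\<^sup>\<sharp>(\<Delta>(\<alpha>(-m)) s, x)t = \<Delta>E(\<alpha>(-m), x) Y\<^sup>\<sharp>(s, x)t + Y\<^sup>\<sharp>(s, x)(Y\<^sub>M(\<alpha>(-m), x) \<otimes> 1)t\<close>, which for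
  \<open>s = \<Delta>u\<close> and \<open>t = \<Delta>w\<close> is the image under \<open>\<Delta>\<close> of the first recursion.  Hence \<open>\<Delta>\<close>
  intertwines the vertex operators, and as \<open>\<Delta>\<close> is injective (by the counit), its image is a vertex
  algebra isomorphic to \<open>M(1)\<close>.\<close>

unbundle fps_syntax

section \<open>Laurent series\<close>

instantiation fls :: (complex_comm_algebra) complex_comm_algebra
begin
text \<open>Scaling is a product with a constant series, so that its compatibility with
  multiplication is associativity.\<close>

definition scaleC_fls :: "complex \<Rightarrow> 'a fls \<Rightarrow> 'a fls"
  where "scaleC_fls c f = fls_const (c *\<^sub>C 1) * f"
instance
proof
  have nth: "(c *\<^sub>C f) $$ n = c *\<^sub>C (f $$ n)" for c n and f :: "'a fls"
    by (simp add: scaleC_fls_def scaleC_mult_left)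
  fix x y :: "'a fls" and c d :: complex
  show "c *\<^sub>C (x + y) = c *\<^sub>C x + c *\<^sub>C y" "(c + d) *\<^sub>C x = c *\<^sub>C x + d *\<^sub>C x"
    "c *\<^sub>C d *\<^sub>C x = (c * d) *\<^sub>C x" "1 *\<^sub>C x = x"
    by (rule fls_eqI; simp add: nth scaleC_add_right scaleC_add_left scaleC_scaleC scaleC_one)+
  show "(c *\<^sub>C x) * y = c *\<^sub>C (x * y)"
    by (simp add: scaleC_fls_def mult.assoc)
qed
end

lemma fls_scaleC_nth [simp]: "(c *\<^sub>C f) $$ n = c *\<^sub>C (f $$ n)"
  by (simp add: scaleC_fls_def scaleC_mult_left)

lemma clinear_fls_nth: "clinear (\<lambda>f. f $$ n)"
  by (rule clinearI) simp_all

lemma fls_sum_nth: "(\<Sum>x\<in>A. f x) $$ n = (\<Sum>x\<in>A. f x $$ n)" for f :: "_ \<Rightarrow> 'a::complex_comm_algebra fls"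
  by (rule clinearD(6)[OF clinear_fls_nth])

lemma clinear_fls_shift: "clinear (fls_shift m :: 'a::complex_comm_algebra fls \<Rightarrow> 'a fls)"
  by (rule clinearI) (rule fls_eqI, simp)+

lemma clinear_fls_const: "clinear (fls_const :: 'a::complex_comm_algebra \<Rightarrow> 'a fls)"
  by (rule clinearI) (rule fls_eqI, simp)+

lemma clinear_id: "clinear (\<lambda>x. x)"
  by (rule clinearI) simp_all

lemma fls_nth_Abs_lower_bound: "(\<And>n. n < N \<Longrightarrow> f n = 0) \<Longrightarrow> Abs_fls f $$ n = f n"
  by (rule nth_Abs_fls_lower_bound) auto

text \<open>A coefficientwise map may kill leading coefficients and so change the subdegree. With
  arbitrary lower bounds and an arbitrary finite index set, several products can be summed over one
  common range.\<close>

lemma fls_times_nth_superset: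
  fixes f g :: "'a::comm_ring_1 fls"
  assumes "\<And>i. i < a \<Longrightarrow> f $$ i = 0" "\<And>i. i < b \<Longrightarrow> g $$ i = 0"
    and "finite A" "{a..n - b} \<subseteq> A"
  shows "(f * g) $$ n = (\<Sum>i\<in>A. f $$ i * g $$ (n - i))"
proof -
  let ?B = "{fls_subdegree f..n - fls_subdegree g}"
  let ?h = "\<lambda>i. f $$ i * g $$ (n - i)"
  have "sum ?h ?B = sum ?h (?B \<union> A)"
  proof (rule sum.mono_neutral_left)
    show "\<forall>i\<in>?B \<union> A - ?B. ?h i = 0"
    proof
      fix i assume "i \<in> ?B \<union> A - ?B"
      then have "i < fls_subdegree f \<or> n - i < fls_subdegree g" by auto
      then show "?h i = 0" by auto
    qed
  qed (use assms(3) in auto)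
  also have "\<dots> = sum ?h A"
  proof (rule sum.mono_neutral_right)
    show "\<forall>i\<in>?B \<union> A - A. ?h i = 0"
    proof
      fix i assume "i \<in> ?B \<union> A - A"
      then have "i \<notin> {a..n - b}" using assms(4) by blast
      then have "i < a \<or> n - i < b" by auto
      then show "?h i = 0" using assms(1,2) by auto
    qed
  qed (use assms(3) in auto)
  finally show ?thesis by (simp add: fls_times_nth(2))
qed

section \<open>Coefficientwise maps of Laurent series\<close>

definition fls_map :: "('a::zero \<Rightarrow> 'b::zero) \<Rightarrow> 'a fls \<Rightarrow> 'b fls"
  where "fls_map \<phi> f = Abs_fls (\<lambda>n. \<phi> (f $$ n))"

lemma fls_map_nth: "\<phi> 0 = 0 \<Longrightarrow> fls_map \<phi> f $$ n = \<phi> (f $$ n)"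
  unfolding fls_map_def by (rule fls_nth_Abs_lower_bound[of "fls_subdegree f"]) simp

context
  fixes \<phi> :: "'a::complex_comm_algebra \<Rightarrow> 'b::complex_comm_algebra"
  assumes lin: "clinear \<phi>"
begin

lemma fls_map_clinear_nth [simp]: "fls_map \<phi> f $$ n = \<phi> (f $$ n)"
  by (rule fls_map_nth) (rule clinearD[OF lin])

lemma clinear_fls_map: "clinear (fls_map \<phi>)"
  by (rule clinearI) (rule fls_eqI, simp add: clinearD[OF lin])+

lemma fls_map_shift: "fls_map \<phi> (fls_shift m f) = fls_shift m (fls_map \<phi> f)"
  by (rule fls_eqI) simp

lemma fls_map_const: "fls_map \<phi> (fls_const a) = fls_const (\<phi> a)"
  by (rule fls_eqI) (simp add: clinearD[OF lin])

lemma fls_map_times_nth: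
  "fls_map \<phi> (f * g) $$ n = (\<Sum>i=fls_subdegree f..n - fls_subdegree g. \<phi> (f $$ i * g $$ (n - i)))"
  by (simp add: fls_times_nth(2) clinearD[OF lin])

lemma fls_map_mult:
  assumes "\<And>a b. \<phi> (a * b) = \<phi> a * \<phi> b"
  shows "fls_map \<phi> (f * g) = fls_map \<phi> f * fls_map \<phi> g"
  by (rule fls_eqI, unfold fls_map_times_nth,
      subst fls_times_nth_superset[of "fls_subdegree f" _ "fls_subdegree g"])
    (simp_all add: assms clinearD[OF lin])

end

lemma fls_map_derivation:
  assumes "derivation D"
  shows "derivation (fls_map D)"
proof -
  have lin: "clinear D" and D: "\<And>a b. D (a * b) = D a * b + a * D b"
    using assms by (auto simp: derivation_def)
  have "fls_map D (f * g) = fls_map D f * g + f * fls_map D g" for f g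
  proof (rule fls_eqI)
    fix n
    let ?A = "{fls_subdegree f..n - fls_subdegree g}"
    have "(fls_map D f * g) $$ n = (\<Sum>i\<in>?A. D (f $$ i) * g $$ (n - i))"
      "(f * fls_map D g) $$ n = (\<Sum>i\<in>?A. f $$ i * D (g $$ (n - i)))"
      by (subst fls_times_nth_superset[of "fls_subdegree f" _ "fls_subdegree g" _ ?A];
          simp add: clinearD[OF lin] lin)+
    then show "fls_map D (f * g) $$ n = (fls_map D f * g + f * fls_map D g) $$ n"
      by (simp only: fls_map_times_nth[OF lin] fls_plus_nth D sum.distrib)
  qed
  then show ?thesis
    using clinear_fls_map[OF lin] by (simp add: derivation_def)
qed


section \<open>Tensor products and symmetric algebras\<close>

lemma tensor_lift_compose:
  assumes f: "cbilinear f" and \<phi>: "clinear \<phi>"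
  shows "\<phi> (tensor_lift f t) = tensor_lift (\<lambda>a b. \<phi> (f a b)) t"
proof -
  have b: "cbilinear (\<lambda>a b. \<phi> (f a b))"
    using cbilinearD[OF f] by (auto simp: cbilinear_def intro: clinear_compose[OF _ \<phi>])
  show ?thesis
    by (rule tensor_eq[OF clinear_compose[OF tensor_lift(1)[OF f] \<phi>] tensor_lift(1)[OF b]])
      (simp add: tensor_lift(2)[OF f] tensor_lift(2)[OF b])
qed

lemma sum_induct_closed:
  fixes f :: "'i \<Rightarrow> 'a::comm_monoid_add"
  assumes "P 0" "\<And>x y. P x \<Longrightarrow> P y \<Longrightarrow> P (x + y)" "\<And>i. i \<in> A \<Longrightarrow> P (f i)"
  shows "P (sum f A)"
  using assms by (induction A rule: infinite_finite_induct) auto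

text \<open>Coefficients are absorbed into the first factor, and the empty sum is the elementary
  tensor of two zeros; closure of \<open>P\<close> under sums is then enough.\<close>

lemma tensor_induct [case_names elem add]:
  assumes elem: "\<And>a b. P (a \<otimes>\<^sub>C b)" and add: "\<And>s t. P s \<Longrightarrow> P t \<Longrightarrow> P (s + t)"
  shows "P t"
proof (induct t rule: tensor.abs_induct)
  case (1 p)
  note bil = cbilinearD[OF cbilinear_tensor_elem]
  have "abs_tensor p = free_lift (\<lambda>(a, b). a \<otimes>\<^sub>C b) p"
    by (rule free_space_eq[OF clinear_abs_tensor clinear_free_lift])
      (auto simp: tensor_elem_abs scaleC_one)
  also have "\<dots> = (\<Sum>(a, b)\<in>Poly_Mapping.keys p. (Poly_Mapping.lookup p (a, b) *\<^sub>C a) \<otimes>\<^sub>C b)"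
    by (auto simp: free_lift_def clinearD[OF bil(2)] intro: sum.cong)
  also have "P \<dots>"
    using elem[of 0 0] by (intro sum_induct_closed[of P]) (auto simp: clinearD[OF bil(1)] elem add)
  finally show ?case .
qed

lemma tensor_elem_left_mult: "(a * b) \<otimes>\<^sub>C 1 = (a \<otimes>\<^sub>C 1) * (b \<otimes>\<^sub>C 1)"
  "1 \<otimes>\<^sub>C (a * b) = (1 \<otimes>\<^sub>C a) * (1 \<otimes>\<^sub>C b)"
  for a b :: "'a::complex_comm_algebra"
  by (simp_all add: tensor_mult)

lemma derivation_1:
  assumes "derivation D"
  shows "D 1 = 0"
proof -
  have "D (1 * 1) = D 1 * 1 + 1 * D 1"
    using assms unfolding derivation_def by blast
  then show ?thesis by simp
qed

lemma derivationD:
  assumes "derivation D"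
  shows "clinear D" "D (a * b) = D a * b + a * D b" "D 1 = 0"
  using assms derivation_1 by (auto simp: derivation_def)

lemma alg_homD:
  assumes "alg_hom g"
  shows "clinear g" "g (a * b) = g a * g b" "g 1 = 1"
  using assms by (auto simp: alg_hom_def)

lemma sym_alg_induct [case_names one add scale gen]:
  assumes one: "P 1" and add: "\<And>x y. P x \<Longrightarrow> P y \<Longrightarrow> P (x + y)"
    and scale: "\<And>c x. P x \<Longrightarrow> P (c *\<^sub>C x)" and gen: "\<And>v x. P x \<Longrightarrow> P (sym_gen v * x)"
  shows "P x"
proof -
  have P0: "P 0" using scale[OF one, of 0] by simp
  have mon: "P (\<Prod>v\<in>#M. sym_gen v)" for M
    by (induction M) (simp_all add: one gen)
  show ?thesis
  proof (induct x rule: sym_alg.abs_induct)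
    case (1 p)
    have "abs_sym_alg p = free_lift (\<lambda>M. \<Prod>v\<in>#M. sym_gen v) p"
      by (rule free_space_eq[OF clinear_abs_sym clinear_free_lift])
        (simp add: abs_sym_single scaleC_one)
    then show ?case
      by (auto simp: free_lift_def intro!: sum_induct_closed[of P] P0 add scale mon)
  qed
qed


section \<open>The Heisenberg algebra\<close>

lemma poly_mapping_sum_single:
  fixes x :: "'a \<Rightarrow>\<^sub>0 'b::comm_monoid_add"
  shows "x = (\<Sum>k\<in>Poly_Mapping.keys x. Poly_Mapping.single k (Poly_Mapping.lookup x k))"
  by (rule poly_mapping_eqI)
    (simp add: lookup_sum lookup_single when_def in_keys_iff)

lemma sym_gen_heis: "sym_gen v = (\<Sum>k\<in>Poly_Mapping.keys v. heis_gen (Poly_Mapping.lookup v k) (Suc k))"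
  by (subst poly_mapping_sum_single) (simp add: clinearD[OF clinear_sym_gen] heis_gen_def)

text \<open>A vector of the direct sum is a finite sum of homogeneous ones, so the modes
  \<alpha>(-p-1) suffice as generators. The index \<open>Suc p\<close> keeps to the range where
  \<open>heis_gen\<close> is meaningful.\<close>

lemma heis_induct [case_names one add scale gen]:
  assumes one: "P 1" and add: "\<And>x y. P x \<Longrightarrow> P y \<Longrightarrow> P (x + y)"
    and scale: "\<And>c x. P x \<Longrightarrow> P (c *\<^sub>C x)" and gen: "\<And>\<alpha> p x. P x \<Longrightarrow> P (heis_gen \<alpha> (Suc p) * x)"
  shows "P x"
proof (induction x rule: sym_alg_induct)
  case (gen v x)
  have "P 0" using scale[OF one, of 0] by simp
  then show ?case
    unfolding sym_gen_heis sum_distrib_right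
    by (intro sum_induct_closed[of P]) (auto intro: assms gen)
qed (fact assms)+

lemma direct_sum_linear:
  fixes f :: "nat \<Rightarrow> 'h::complex_vector \<Rightarrow> 'b::complex_vector"
  assumes f: "\<And>k. clinear (f k)"
  defines "F \<equiv> \<lambda>x. \<Sum>k\<in>Poly_Mapping.keys x. f k (Poly_Mapping.lookup x k)"
  shows "clinear F" "F (Poly_Mapping.single k a) = f k a"
proof -
  note fD = clinearD[OF f]
  have sup: "F x = (\<Sum>k\<in>A. f k (Poly_Mapping.lookup x k))"
    if "finite A" "Poly_Mapping.keys x \<subseteq> A" for A x
    unfolding F_def using that by (intro sum.mono_neutral_left) (auto simp: in_keys_iff fD)
  show "clinear F"
  proof (rule clinearI)
    fix x y :: "nat \<Rightarrow>\<^sub>0 'h" and c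
    let ?A = "Poly_Mapping.keys x \<union> Poly_Mapping.keys y"
    show "F (x + y) = F x + F y"
      using Poly_Mapping.keys_add[of x y]
      by (simp add: sup[of ?A] lookup_add fD sum.distrib)
    have "Poly_Mapping.keys (c *\<^sub>C x) \<subseteq> Poly_Mapping.keys x"
      by (auto simp: in_keys_iff)
    then show "F (c *\<^sub>C x) = c *\<^sub>C F x"
      by (simp add: sup[of "Poly_Mapping.keys x"] fD cvs.scale_sum_right)
  qed
  show "F (Poly_Mapping.single k a) = f k a"
    by (subst sup[of "{k}"]) auto
qed

lemma heis_derivation_ext:
  assumes D: "derivation D" and E: "derivation E"
    and eq: "\<And>\<alpha> p. D (heis_gen \<alpha> (Suc p)) = E (heis_gen \<alpha> (Suc p))"
  shows "D x = E x"
  by (induction x rule: heis_induct)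
    (simp_all add: derivationD[OF D] derivationD[OF E] eq clinearD[OF derivationD(1)[OF D]]
      clinearD[OF derivationD(1)[OF E]])

text \<open>Resolves the \<open>THE\<close> in both \<open>heis_L\<close> and the positive modes of
  \<open>heis_op\<close>, which have this common shape.\<close>

lemma the_heis_derivation:
  fixes f :: "nat \<Rightarrow> 'h::complex_vector \<Rightarrow> 'h heis"
  assumes f: "\<And>n. clinear (f n)"
  defines "D \<equiv> THE D. derivation D \<and> (\<forall>a. \<forall>n\<ge>1. D (heis_gen a n) = f n a)"
  shows "derivation D" "D (heis_gen a (Suc p)) = f (Suc p) a"
proof -
  note F = direct_sum_linear[of "\<lambda>k. f (Suc k)", OF f]
  from ex1_sym_derivation[OF F(1)] obtain E where E: "derivation E"
    "\<And>v. E (sym_gen v) = (\<Sum>k\<in>Poly_Mapping.keys v. f (Suc k) (Poly_Mapping.lookup v k))"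
    by blast
  have ex: "derivation E \<and> (\<forall>a. \<forall>n\<ge>1. E (heis_gen a n) = f n a)"
    using E by (auto simp: heis_gen_def clinearD(3)[OF f])
  have "D = E"
    unfolding D_def
  proof (rule the_equality)
    show "derivation E \<and> (\<forall>a. \<forall>n\<ge>1. E (heis_gen a n) = f n a)" by (fact ex)
    fix D' assume D': "derivation D' \<and> (\<forall>a. \<forall>n\<ge>1. D' (heis_gen a n) = f n a)"
    show "D' = E"
      by (rule ext, rule heis_derivation_ext) (use D' ex in auto)
  qed
  with ex show "derivation D" "D (heis_gen a (Suc p)) = f (Suc p) a" by auto
qed

lemma clinear_heis_gen: "clinear (\<lambda>\<alpha>. heis_gen \<alpha> n)"
proof -
  have "clinear (Poly_Mapping.single k :: 'h::complex_vector \<Rightarrow> nat \<Rightarrow>\<^sub>0 'h)" for k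
    by (rule clinearI) (simp_all add: single_add)
  from clinear_compose[OF this clinear_sym_gen] show ?thesis by (simp add: heis_gen_def)
qed

lemma clinear_scale: "clinear f \<Longrightarrow> clinear (\<lambda>x. c *\<^sub>C f x)"
  by (rule clinearI) (simp_all add: clinearD scaleC_add_right scaleC_scaleC mult.commute)

lemma heis_L: "derivation heis_L"
  "heis_L (heis_gen \<alpha> (Suc p)) = of_nat (Suc p) *\<^sub>C heis_gen \<alpha> (Suc (Suc p))"
proof -
  have "clinear (\<lambda>\<alpha>. of_nat n *\<^sub>C heis_gen \<alpha> (n + 1))" for n
    by (intro clinear_scale clinear_heis_gen)
  from the_heis_derivation[of "\<lambda>n \<alpha>. of_nat n *\<^sub>C heis_gen \<alpha> (n + 1)", OF this]
  show "derivation heis_L" "heis_L (heis_gen \<alpha> (Suc p)) = of_nat (Suc p) *\<^sub>C heis_gen \<alpha> (Suc (Suc p))"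
    unfolding heis_L_def by simp_all
qed

text \<open>The mode 0 is the zero map, which is also a derivation; as 0 is never
  \<open>Suc p\<close>, one formula covers all nonnegative modes.\<close>

lemma heis_op_derivation:
  assumes form: "cbilinear form"
  shows "derivation (heis_op form \<alpha> (int n))"
    "heis_op form \<alpha> (int n) (heis_gen \<beta> (Suc p))
      = (if n = Suc p then (of_nat n * form \<alpha> \<beta>) *\<^sub>C 1 else 0)"
proof -
  have lin: "clinear (\<lambda>\<beta>. (if int m = int n then (of_int (int n) * form \<alpha> \<beta>) *\<^sub>C 1 else 0))" for m
    by (rule clinearI) (simp_all add: clinearD[OF cbilinearD(1)[OF form]] scaleC_complex_def
        distrib_left scaleC_add_left scaleC_scaleC mult_ac)
  note D = the_heis_derivation[of "\<lambda>m \<beta>. (if int m = int n then (of_int (int n) * form \<alpha> \<beta>) *\<^sub>C 1 else 0)", OF lin]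
  have zero: "derivation (\<lambda>_. 0)"
    by (auto simp: derivation_def intro: clinearI)
  show "derivation (heis_op form \<alpha> (int n))"
    "heis_op form \<alpha> (int n) (heis_gen \<beta> (Suc p))
      = (if n = Suc p then (of_nat n * form \<alpha> \<beta>) *\<^sub>C 1 else 0)"
    using D zero by (cases "n = 0"; simp add: heis_op_def)+
qed

lemma heis_Delta: "alg_hom heis_Delta"
  "heis_Delta (heis_gen \<alpha> n) = heis_gen \<alpha> n \<otimes>\<^sub>C 1 + 1 \<otimes>\<^sub>C heis_gen \<alpha> n"
proof -
  note bil = cbilinearD[OF cbilinear_tensor_elem]
  have lin: "clinear (\<lambda>a. sym_gen a \<otimes>\<^sub>C 1 + 1 \<otimes>\<^sub>C sym_gen a)"
    by (intro clinear_add clinear_compose[OF clinear_sym_gen bil(1)]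
        clinear_compose[OF clinear_sym_gen bil(2)])
  show "alg_hom heis_Delta"
    "heis_Delta (heis_gen \<alpha> n) = heis_gen \<alpha> n \<otimes>\<^sub>C 1 + 1 \<otimes>\<^sub>C heis_gen \<alpha> n"
    unfolding heis_Delta_def heis_gen_def using sym_lift[OF lin] by simp_all
qed

text \<open>A left inverse is id \<otimes> \<epsilon>, with \<epsilon> the counit. It is
  multiplicative, and on \<Delta>(\<alpha>(-n)) it kills the summand with the generator on the
  right, so the identity is checked on generators.\<close>

lemma inj_heis_Delta: "inj (heis_Delta :: 'h::complex_vector heis \<Rightarrow> _)"
proof -
  have lin0: "clinear (\<lambda>v. 0 :: complex)" by (rule clinearI) simp_all
  define \<epsilon> :: "'h heis \<Rightarrow> complex" where "\<epsilon> = sym_lift (\<lambda>v. 0)"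
  have \<epsilon>: "alg_hom \<epsilon>" "\<epsilon> (sym_gen v) = 0" for v
    unfolding \<epsilon>_def by (rule sym_lift[OF lin0])+
  note \<epsilon>D = alg_homD[OF \<epsilon>(1)] clinearD[OF alg_homD(1)[OF \<epsilon>(1)]]
  let ?f = "\<lambda>(a :: 'h heis) (b :: 'h heis). \<epsilon> b *\<^sub>C a"
  have bil: "cbilinear ?f"
    unfolding cbilinear_def
    by (intro conjI allI clinearI)
      (simp_all add: \<epsilon>D scaleC_add_left scaleC_add_right scaleC_scaleC scaleC_complex_def mult.commute)
  note \<pi> = tensor_lift[OF bil]
  have mult: "tensor_lift ?f (s * t) = tensor_lift ?f s * tensor_lift ?f t" for s t
  proof (induction s rule: tensor_induct)
    case (elem a b)
    show ?case
      by (induction t rule: tensor_induct)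
        (simp_all add: \<pi>(2) tensor_mult distrib_left clinearD[OF \<pi>(1)] \<epsilon>D scaleC_mult_left
          scaleC_mult_right scaleC_scaleC mult_ac)
  qed (simp_all add: distrib_right clinearD[OF \<pi>(1)])
  have inv: "tensor_lift ?f (heis_Delta x) = x" for x
  proof (induction x rule: heis_induct)
    case one
    then show ?case
      by (simp add: alg_homD[OF heis_Delta(1)] one_tensor_def \<pi>(2) \<epsilon>D scaleC_one)
  next
    case (gen \<alpha> p x)
    have "\<epsilon> (heis_gen \<alpha> (Suc p)) = 0" by (simp add: heis_gen_def \<epsilon>)
    with gen show ?case
      by (simp add: alg_homD[OF heis_Delta(1)] heis_Delta(2) mult clinearD[OF \<pi>(1)] \<pi>(2) \<epsilon>D scaleC_one)
  qed (simp_all add: clinearD[OF alg_homD(1)[OF heis_Delta(1)]] clinearD[OF \<pi>(1)])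
  show ?thesis by (rule inj_on_inverseI[where g = "tensor_lift ?f"], rule inv)
qed


section \<open>The iterate formula\<close>

text \<open>Vanishing for negative \<open>j\<close> encodes the expansion of a binomial in
  nonnegative powers of one variable, and makes Pascal's rule hold for every integer
  \<open>j\<close>.\<close>

definition gbin :: "int \<Rightarrow> int \<Rightarrow> complex"
  where "gbin e j = (if j \<ge> 0 then of_int e gchoose nat j else 0)"

lemma gbin_Pascal: "gbin (e + 1) j = gbin e j + gbin e (j - 1)"
proof (cases "j > 0")
  case True
  then obtain k where k: "j = int (Suc k)" by (metis gr0_implies_Suc pos_int_cases)
  show ?thesis by (simp add: gbin_def k nat_add_distrib gbinomial_Suc_Suc)
qed (auto simp: gbin_def)

lemma gbin_0: "gbin 0 j = (if j = 0 then 1 else 0)"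
  by (cases "nat j") (auto simp: gbin_def)

lemma gbin_nat: "gbin e (int k) = of_int e gchoose k"
  by (simp add: gbin_def)

lemma gchoose_neg: "(of_int (- int (Suc n)) :: complex) gchoose k = (-1) ^ k * of_nat ((n + k) choose k)"
proof -
  have "(of_int (- int (Suc n)) :: complex) gchoose k = (-1) ^ k * (of_nat (n + k) gchoose k)"
    by (subst gbinomial_negated_upper) (simp add: algebra_simps)
  then show ?thesis by (simp add: binomial_gbinomial)
qed

lemma gchoose_nat_less: "(of_int m :: complex) gchoose j = 0" if "0 \<le> m" "m < int j"
proof -
  have "of_int m = (of_nat (nat m) :: complex)" using that by simp
  then show ?thesis
    using that by (metis binomial_eq_0 binomial_gbinomial nat_less_iff of_nat_0)
qed

section \<open>Formal series in two variables\<close>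

text \<open>Multiplication of a series in \<open>x\<^sub>0, x\<^sub>2\<close> by \<open>x\<^sub>0 + x\<^sub>2\<close>.\<close>

definition mul_sum :: "(int \<Rightarrow> int \<Rightarrow> 'a::ab_group_add) \<Rightarrow> int \<Rightarrow> int \<Rightarrow> 'a"
  where "mul_sum F p q = F (p - 1) q + F p (q - 1)"

lemma mul_sum_pow_diff:
  "(mul_sum ^^ l) (\<lambda>p q. F p q - G p q) = (\<lambda>p q. (mul_sum ^^ l) F p q - (mul_sum ^^ l) G p q)"
  by (induction l) (simp_all add: mul_sum_def fun_eq_iff)

lemma mul_sum_pow_sum:
  "(mul_sum ^^ l) (\<lambda>p q. \<Sum>n\<in>A. F n p q) = (\<lambda>p q. \<Sum>n\<in>A. (mul_sum ^^ l) (F n) p q)"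
  by (induction l) (simp_all add: mul_sum_def fun_eq_iff sum.distrib)

text \<open>The coefficient at \<open>(p, q + 1)\<close> of the product expresses
  \<open>F p q\<close> through \<open>F (p - 1) (q + 1)\<close>, so everything vanishes by induction
  from p < 0. Truncation in x0 is essential: the sum of (-1)^n x0^n x2^(-n-1) over all integers n is
  killed by x0 + x2.\<close>

lemma mul_sum_eq_0:
  assumes F: "mul_sum F = (\<lambda>_ _. 0)" and F0: "\<And>p q. p < 0 \<Longrightarrow> F p q = 0"
  shows "F = (\<lambda>_ _. 0)"
proof -
  have "F (int p) q = 0" for p q
  proof (induction p arbitrary: q)
    case 0
    then show ?case using fun_cong[OF fun_cong[OF F, of 0], of "q + 1"] F0 by (simp add: mul_sum_def)
  next
    case (Suc p)
    then show ?case
      using fun_cong[OF fun_cong[OF F, of "int (Suc p)"], of "q + 1"] by (simp add: mul_sum_def)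
  qed
  then have "F p q = 0" for p q
    using F0[of p q] by (cases "p < 0") (simp_all, metis nat_0_le not_le)
  then show ?thesis by blast
qed

lemma mul_sum_pow_eq_0:
  assumes "(mul_sum ^^ l) F = (\<lambda>_ _. 0)" and "\<And>p q. p < 0 \<Longrightarrow> F p q = 0"
  shows "F = (\<lambda>_ _. 0)"
  using assms
proof (induction l arbitrary: F)
  case 0
  then show ?case by (simp only: funpow.simps id_apply)
next
  case (Suc l)
  have "(mul_sum ^^ l) (mul_sum F) = (\<lambda>_ _. 0)"
    using Suc.prems(1) by (simp only: funpow_Suc_right o_apply)
  moreover have "mul_sum F p q = 0" if "p < 0" for p q
    using that Suc.prems(2) by (simp add: mul_sum_def)
  ultimately have "mul_sum F = (\<lambda>_ _. 0)" by (rule Suc.IH)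
  then show ?case using Suc.prems(2) by (rule mul_sum_eq_0)
qed

text \<open>The two expansions of \<open>(x\<^sub>0 + x\<^sub>2)\<^sup>-\<^sup>m g(x\<^sub>2)\<close>, in nonnegative powers of \<open>x\<^sub>2\<close> and of
  \<open>x\<^sub>0\<close>, agree after multiplication by \<open>(x\<^sub>0 + x\<^sub>2)\<^sup>l\<close> for \<open>l \<ge> m\<close>.\<close>

lemma mul_sum_pow_expansions:
  fixes g :: "int \<Rightarrow> 'a::complex_vector"
  assumes "m \<le> l"
  shows "(mul_sum ^^ l) (\<lambda>p q. gbin (- int m) (- int m - p) *\<^sub>C g (q + int m + p))
    = (mul_sum ^^ l) (\<lambda>p q. gbin (- int m) p *\<^sub>C g (q + int m + p))"
proof -
  define \<Phi> where "\<Phi> m p q = gbin (- int m) (- int m - p) *\<^sub>C g (q + int m + p)" for m p q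
  define \<Psi> where "\<Psi> m p q = gbin (- int m) p *\<^sub>C g (q + int m + p)" for m p q
  have gbin: "gbin (- int m) j = gbin (- int (Suc m)) j + gbin (- int (Suc m)) (j - 1)" for m j
    using gbin_Pascal[of "- int (Suc m)"] by simp
  have g: "g (q + int (Suc m) + (p - 1)) = g (q + int m + p)"
    "g (q - 1 + int (Suc m) + p) = g (q + int m + p)" for m p q
    by (rule arg_cong[of _ _ g], simp)+
  have "- int (Suc m) - (p - 1) = - int m - p" "- int (Suc m) - p = - int m - p - 1" for m p
    by simp_all
  then have \<Phi>: "mul_sum (\<Phi> (Suc m)) = \<Phi> m" for m
    unfolding mul_sum_def \<Phi>_def g gbin[of m] by (simp only: scaleC_add_left)
  have \<Psi>: "mul_sum (\<Psi> (Suc m)) = \<Psi> m" for m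
    unfolding mul_sum_def \<Psi>_def g gbin[of m] by (simp only: scaleC_add_left add.commute)
  \<comment> \<open>By Pascal's rule each factor x0 + x2 lowers the pole order by one in either
    expansion; after m factors both have become g(x2).\<close>
  have "(mul_sum ^^ m) (\<Phi> m) = \<Phi> 0" "(mul_sum ^^ m) (\<Psi> m) = \<Psi> 0" for m
    by (induction m; simp add: funpow_Suc_right \<Phi> \<Psi> del: funpow.simps(2))+
  moreover have "\<Phi> 0 = \<Psi> 0"
    by (auto simp: \<Phi>_def \<Psi>_def fun_eq_iff gbin_0)
  moreover have "mul_sum ^^ l = (mul_sum ^^ (l - m)) \<circ> ((mul_sum ^^ m) :: (int \<Rightarrow> int \<Rightarrow> 'a) \<Rightarrow> _)"
    using assms by (simp flip: funpow_add)
  ultimately show ?thesis by (simp flip: \<Phi>_def \<Psi>_def)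
qed

text \<open>The left-hand side of weak associativity, for \<open>f\<close> the series \<open>Y\<^sub>W(u, x\<^sub>1) Y\<^sub>W(v, x\<^sub>2) w\<close>.\<close>

definition expand_sum :: "nat \<Rightarrow> (int \<Rightarrow> int \<Rightarrow> 'a::complex_vector) \<Rightarrow> int \<Rightarrow> int \<Rightarrow> 'a"
  where "expand_sum l f p q =
    Sum_any (\<lambda>j::nat. (of_int (p + int j) gchoose j) *\<^sub>C f (p + int j - int l) (q - int j))"

lemma expand_sum_finite:
  assumes "\<And>k r. r < R \<Longrightarrow> f k r = 0" and "q - R \<le> int J"
  shows "expand_sum l f p q =
    (\<Sum>j\<le>J. (of_int (p + int j) gchoose j) *\<^sub>C f (p + int j - int l) (q - int j))"
  unfolding expand_sum_def
proof (rule Sum_any.expand_superset)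
  show "{j. (of_int (p + int j) gchoose j) *\<^sub>C f (p + int j - int l) (q - int j) \<noteq> 0} \<subseteq> {..J}"
  proof
    fix j assume "j \<in> {j. (of_int (p + int j) gchoose j) *\<^sub>C f (p + int j - int l) (q - int j) \<noteq> 0}"
    then have "f (p + int j - int l) (q - int j) \<noteq> 0" by auto
    then have "\<not> q - int j < R" using assms(1) by blast
    then show "j \<in> {..J}" using assms(2) by simp
  qed
qed simp

text \<open>Pascal's rule again. It splits the factor (x0 + x2)^l off the substitution x1 = x0 + x2,
  which makes sense already for l = 0 because \<open>f\<close> is truncated in x2.\<close>

lemma expand_sum_Suc:
  assumes f: "\<And>k r. r < R \<Longrightarrow> f k r = 0"
  shows "expand_sum (Suc l) f = mul_sum (expand_sum l f)"
proof (intro ext)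
  fix p q
  define J where "J = nat (q - R)"
  have J: "q - R \<le> int (Suc J)" "q - 1 - R \<le> int J" by (auto simp: J_def)
  let ?t = "\<lambda>l p q j. (of_int (p + int j) gchoose j) *\<^sub>C f (p + int j - int l) (q - int j)"
  have zero: "?t (Suc l) p q 0 = ?t l (p - 1) q 0"
    by (simp add: algebra_simps)
  have Suc: "?t (Suc l) p q (Suc j) = ?t l (p - 1) q (Suc j) + ?t l p (q - 1) j" for j
  proof -
    have "(of_int (p + int (Suc j)) :: complex) gchoose Suc j
        = (of_int (p - 1 + int (Suc j)) gchoose Suc j) + (of_int (p + int j) gchoose j)"
      using gbinomial_Suc_Suc[of "of_int (p + int j) :: complex" j] by (simp add: add_ac)
    moreover have "p + int (Suc j) - int (Suc l) = p + int j - int l"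
      "p - 1 + int (Suc j) - int l = p + int j - int l" "q - int (Suc j) = q - 1 - int j"
      by simp_all
    ultimately show ?thesis by (simp only: scaleC_add_left)
  qed
  have "expand_sum (Suc l) f p q = (\<Sum>j\<le>Suc J. (of_int (p + int j) gchoose j) *\<^sub>C f (p + int j - int (Suc l)) (q - int j))"
    "expand_sum l f (p - 1) q = (\<Sum>j\<le>Suc J. (of_int (p - 1 + int j) gchoose j) *\<^sub>C f (p - 1 + int j - int l) (q - int j))"
    "expand_sum l f p (q - 1) = (\<Sum>j\<le>J. (of_int (p + int j) gchoose j) *\<^sub>C f (p + int j - int l) (q - 1 - int j))"
    using f J by (intro expand_sum_finite[of R]; simp)+
  then show "expand_sum (Suc l) f p q = mul_sum (expand_sum l f) p q"
    unfolding mul_sum_def sum.atMost_Suc_shift by (simp only: zero Suc sum.distrib add.assoc)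
qed

lemma expand_sum_pow:
  assumes f: "\<And>k r. r < R \<Longrightarrow> f k r = 0"
  shows "expand_sum l f = (mul_sum ^^ l) (expand_sum 0 f)"
  by (induction l) (simp_all add: expand_sum_Suc[of R f, OF f])

text \<open>Puts the right-hand side of weak associativity into the same form as the left one in
  \<open>expand_sum_pow\<close>, so that the two can be subtracted.\<close>

lemma binomial_sum_pow:
  fixes G :: "int \<Rightarrow> int \<Rightarrow> 'a::complex_vector"
  shows "(\<Sum>i\<le>l. of_nat (l choose i) *\<^sub>C G (p - int (l - i)) (q - int i)) = (mul_sum ^^ l) G p q"
proof (induction l arbitrary: p q)
  case (Suc l)
  define h where "h i = G (p - int (Suc l) + int i) (q - int i)" for i
  have "(\<Sum>i\<le>Suc l. of_nat (Suc l choose i) *\<^sub>C G (p - int (Suc l - i)) (q - int i))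
    = (\<Sum>i\<le>Suc l. of_nat (Suc l choose i) *\<^sub>C h i)"
    by (intro sum.cong) (auto simp: h_def of_nat_diff algebra_simps)
  also have "\<dots> = h 0 + (\<Sum>i\<le>l. of_nat (l choose Suc i) *\<^sub>C h (Suc i))
      + (\<Sum>i\<le>l. of_nat (l choose i) *\<^sub>C h (Suc i))"
    unfolding sum.atMost_Suc_shift by (simp add: scaleC_add_left scaleC_one sum.distrib add_ac)
  also have "h 0 + (\<Sum>i\<le>l. of_nat (l choose Suc i) *\<^sub>C h (Suc i)) = (\<Sum>i\<le>Suc l. of_nat (l choose i) *\<^sub>C h i)"
    unfolding sum.atMost_Suc_shift by (simp add: scaleC_one)
  also have "\<dots> = (\<Sum>i\<le>l. of_nat (l choose i) *\<^sub>C h i)" by simp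
  also have "\<dots> = (\<Sum>i\<le>l. of_nat (l choose i) *\<^sub>C G ((p - 1) - int (l - i)) (q - int i))"
    by (intro sum.cong) (auto simp: h_def of_nat_diff algebra_simps)
  also have "\<dots> = (mul_sum ^^ l) G (p - 1) q" by (rule Suc.IH)
  also have "(\<Sum>i\<le>l. of_nat (l choose i) *\<^sub>C h (Suc i))
      = (\<Sum>i\<le>l. of_nat (l choose i) *\<^sub>C G (p - int (l - i)) ((q - 1) - int i))"
    by (intro sum.cong) (auto simp: h_def of_nat_diff algebra_simps)
  also have "\<dots> = (mul_sum ^^ l) G p (q - 1)" by (rule Suc.IH)
  finally show ?case by (simp only: funpow.simps o_apply mul_sum_def[of "(mul_sum ^^ l) G"])
qed (simp add: scaleC_one)

text \<open>Choosing j and then i elements is choosing i and then j, so the binomial P over i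
  factors out and the expansion of (1 - 1)^(P - i) remains.\<close>

lemma alternating_trinomial_sum:
  assumes "i \<le> P"
  shows "(\<Sum>j\<le>P - i. (- 1) ^ j * of_nat (P choose j) * of_nat ((P - j) choose i))
    = (if i = P then 1 else 0 :: complex)"
proof -
  have "(\<Sum>j\<le>P - i. (- 1) ^ j * of_nat (P choose j) * of_nat ((P - j) choose i))
    = (\<Sum>j\<le>P - i. of_nat (P choose i) * ((- 1) ^ j * of_nat ((P - i) choose j)) :: complex)"
  proof (intro sum.cong refl)
    fix j assume "j \<in> {..P - i}"
    then have "(P choose j) * ((P - j) choose i) = (P choose i) * ((P - i) choose j)"
      using assms choose_mult[of j "i + j" P] choose_mult[of i "i + j" P]
      by (simp add: binomial_symmetric[of i "i + j"])
    then show "(- 1) ^ j * of_nat (P choose j) * of_nat ((P - j) choose i)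
      = of_nat (P choose i) * ((- 1) ^ j * of_nat ((P - i) choose j) :: complex)"
      by (metis (no_types, lifting) mult.assoc mult.left_commute of_nat_mult)
  qed
  also have "\<dots> = of_nat (P choose i) * (\<Sum>j\<le>P - i. (- 1) ^ j * of_nat ((P - i) choose j))"
    by (simp add: sum_distrib_left)
  also have "\<dots> = (if i = P then 1 else 0)"
    using choose_alternating_sum[of "P - i", where ?'a = complex] assms by auto
  finally show ?thesis .
qed

lemma sum_triangle_swap:
  fixes h :: "nat \<Rightarrow> nat \<Rightarrow> 'a::comm_monoid_add"
  shows "(\<Sum>j\<le>P. \<Sum>i\<le>P - j. h j i) = (\<Sum>i\<le>P. \<Sum>j\<le>P - i. h j i)"
proof -
  have "(\<Sum>(j, i)\<in>(SIGMA j:{..P}. {..P - j}). h j i) = (\<Sum>(i, j)\<in>(SIGMA i:{..P}. {..P - i}). h j i)"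
    by (rule sum.reindex_bij_witness[of _ "\<lambda>(a, b). (b, a)" "\<lambda>(a, b). (b, a)"]) auto
  then show ?thesis by (simp add: sum.Sigma)
qed

text \<open>The expansion of \<open>Y\<^sub>W(a, x\<^sub>1) Y\<^sub>W(u, x\<^sub>2) w\<close> at \<open>x\<^sub>1 = x\<^sub>0 + x\<^sub>2\<close> differs from
  \<open>Y\<^sub>W(Y(a, x\<^sub>0)u, x\<^sub>2) w\<close> by a series \<open>F\<close> with \<open>(x\<^sub>0 + x\<^sub>2)\<^sup>l F = 0\<close>.  By the commutator formula for
  the annihilation modes of \<open>a\<close>, the coefficients of negative powers of \<open>x\<^sub>0\<close> cancel, up to the
  terms \<open>Y\<^sub>W(u, x\<^sub>2) a\<^sub>n w (x\<^sub>0 + x\<^sub>2)\<^sup>-\<^sup>n\<^sup>-\<^sup>1\<close>.  Re-expanding these in nonnegative powers of \<open>x\<^sub>0\<close>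
  leaves a series without negative powers of \<open>x\<^sub>0\<close>, on which \<open>x\<^sub>0 + x\<^sub>2\<close> acts injectively.\<close>

lemma iterate_formula:
  assumes YW: "vertex_operator_map UNIV UNIV YW"
    and assoc: "weak_associativity Y YW a u w"
    and comm: "\<And>n r. YW a (YW u w r) (- int n - 1) = YW u (YW a w (- int n - 1)) r
        + (\<Sum>i\<le>n. of_nat (n choose i) *\<^sub>C YW (Y a u (- int i - 1)) w (r - int n + int i))"
    and N: "\<And>n. n \<ge> N \<Longrightarrow> YW a w (- int n - 1) = 0"
  shows "YW (Y a u (int p)) w q =
    expand_sum 0 (\<lambda>k r. YW a (YW u w r) k) (int p) q
    + (\<Sum>n<N. (of_int (- int (Suc n)) gchoose p) *\<^sub>C
        YW u (YW a w (- int n - 1)) (q + int (Suc n) + int p))"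
proof -
  define f where "f k r = YW a (YW u w r) k" for k r
  define G where "G s r = YW (Y a u s) w r" for s r
  define g where "g n r = YW u (YW a w (- int n - 1)) r" for n r
  obtain R where "\<And>r. r < R \<Longrightarrow> YW u w r = 0"
    using YW unfolding vertex_operator_map_def by blast
  moreover have YW0: "YW v 0 k = 0" for v k
  proof -
    have "clinear_on UNIV (\<lambda>w. YW v w k)"
      using YW unfolding vertex_operator_map_def by blast
    then have "YW v (0 *\<^sub>C 0) k = 0 *\<^sub>C YW v 0 k" unfolding clinear_on_def by blast
    then show ?thesis by simp
  qed
  ultimately have f0: "\<And>k r. r < R \<Longrightarrow> f k r = 0" by (simp add: f_def)
  have g0: "g n r = 0" if "n \<ge> N" for n r by (simp add: g_def N that YW0)
  have f_neg: "f (- int n - 1) r = g n r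
      + (\<Sum>i\<le>n. of_nat (n choose i) *\<^sub>C G (- int i - 1) (r - int n + int i))" for n r
    by (simp add: f_def g_def G_def comm)
  define \<Phi> where "\<Phi> n p q = gbin (- int (Suc n)) (- int (Suc n) - p) *\<^sub>C g n (q + int (Suc n) + p)" for n p q
  define \<Psi> where "\<Psi> n p q = gbin (- int (Suc n)) p *\<^sub>C g n (q + int (Suc n) + p)" for n p q
  have neg: "expand_sum 0 f (- int P - 1) q = (\<Sum>n<N. \<Phi> n (- int P - 1) q) + G (- int P - 1) q" for P q
  proof -
    define J where "J = nat (q - R) + P"
    have J: "q - R \<le> int J" by (simp add: J_def)
    have "expand_sum 0 f (- int P - 1) q
        = (\<Sum>j\<le>J. (of_int (- int P - 1 + int j) gchoose j) *\<^sub>C f (- int P - 1 + int j) (q - int j))"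
      using expand_sum_finite[of R f q J 0 "- int P - 1", OF f0 J] by simp
    \<comment> \<open>For j > P the exponent -P-1+j is nonnegative and smaller than j, so the
      binomial coefficient is zero. Only annihilation modes are left, and to these the commutator
      formula applies.\<close>
    also have "\<dots> = (\<Sum>j\<le>P. (of_int (- int P - 1 + int j) gchoose j) *\<^sub>C f (- int P - 1 + int j) (q - int j))"
    proof (rule sum.mono_neutral_right)
      show "\<forall>j\<in>{..J} - {..P}. (of_int (- int P - 1 + int j) gchoose j) *\<^sub>C f (- int P - 1 + int j) (q - int j) = 0"
      proof
        fix j assume "j \<in> {..J} - {..P}"
        then have "(of_int (- int P - 1 + int j) :: complex) gchoose j = 0"
          by (intro gchoose_nat_less) auto
        then show "(of_int (- int P - 1 + int j) gchoose j) *\<^sub>C f (- int P - 1 + int j) (q - int j) = 0"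
          by (simp only: cvs.scale_zero_left)
      qed
    qed (auto simp: J_def)
    also have "\<dots> = (\<Sum>j\<le>P. ((- 1) ^ j * of_nat (P choose j)) *\<^sub>C f (- int (P - j) - 1) (q - int j))"
    proof (intro sum.cong refl)
      fix j assume "j \<in> {..P}"
      then have e: "- int P - 1 + int j = - int (Suc (P - j))" and e': "P - j + j = P" by auto
      show "(of_int (- int P - 1 + int j) gchoose j) *\<^sub>C f (- int P - 1 + int j) (q - int j)
        = ((- 1) ^ j * of_nat (P choose j)) *\<^sub>C f (- int (P - j) - 1) (q - int j)"
        unfolding e gchoose_neg e' by (simp only: of_nat_Suc minus_add_distrib diff_conv_add_uminus add.commute)
    qed
    also have "\<dots> = (\<Sum>j\<le>P. ((- 1) ^ j * of_nat (P choose j)) *\<^sub>C g (P - j) (q - int j))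
        + (\<Sum>j\<le>P. \<Sum>i\<le>P - j. ((- 1) ^ j * of_nat (P choose j) * of_nat ((P - j) choose i)) *\<^sub>C
            G (- int i - 1) (q - int P + int i))"
      by (simp only: f_neg scaleC_add_right sum.distrib cvs.scale_sum_right scaleC_scaleC, simp)
    also have "(\<Sum>j\<le>P. \<Sum>i\<le>P - j. ((- 1) ^ j * of_nat (P choose j) * of_nat ((P - j) choose i)) *\<^sub>C
            G (- int i - 1) (q - int P + int i))
        = (\<Sum>i\<le>P. \<Sum>j\<le>P - i. ((- 1) ^ j * of_nat (P choose j) * of_nat ((P - j) choose i)) *\<^sub>C
            G (- int i - 1) (q - int P + int i))"
      by (rule sum_triangle_swap)
    \<comment> \<open>The commutator formula enters as a binomial transform of the coefficients of
      \<open>G\<close>; the alternating sum inverts it.\<close>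
    also have "\<dots> = (\<Sum>i\<le>P. (if i = P then 1 else 0) *\<^sub>C G (- int i - 1) (q - int P + int i))"
      by (intro sum.cong refl) (simp only: cvs.scale_sum_left[symmetric] atMost_iff alternating_trinomial_sum)
    also have "\<dots> = G (- int P - 1) q"
      by (simp add: if_distrib[of "\<lambda>c. c *\<^sub>C _"] scaleC_one cong: if_cong)
    also have "(\<Sum>j\<le>P. ((- 1) ^ j * of_nat (P choose j)) *\<^sub>C g (P - j) (q - int j))
        = (\<Sum>n\<le>P. \<Phi> n (- int P - 1) q)"
    proof (rule sum.reindex_bij_witness[of _ "\<lambda>n. P - n" "\<lambda>j. P - j"])
      fix j assume j: "j \<in> {..P}"
      then have e: "- int (Suc (P - j)) - (- int P - 1) = int j" and e': "P - j + j = P" by auto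
      show "\<Phi> (P - j) (- int P - 1) q = ((- 1) ^ j * of_nat (P choose j)) *\<^sub>C g (P - j) (q - int j)"
        unfolding \<Phi>_def e gbin_nat gchoose_neg e' using j by (simp add: of_nat_diff)
    qed auto
    \<comment> \<open>The bound P is traded for N: the binomial coefficient in \<Phi> vanishes for n
      > P, and \<open>g n\<close> vanishes for n \<ge> N.\<close>
    also have "\<dots> = (\<Sum>n\<in>{..P} \<union> {..<N}. \<Phi> n (- int P - 1) q)"
      by (rule sum.mono_neutral_left) (auto simp: \<Phi>_def gbin_def)
    also have "\<dots> = (\<Sum>n<N. \<Phi> n (- int P - 1) q)"
      by (rule sum.mono_neutral_right) (auto simp: \<Phi>_def g0)
    finally show ?thesis .
  qed
  \<comment> \<open>\<open>F\<close> is cut off at p < 0 by definition. The next claim shows that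
    this loses only \<Phi>: for p \<ge> 0 all \<Phi> vanish, and for p < 0 all \<Psi> vanish and
    \<open>neg\<close> gives the rest.\<close>
  define F where "F p q = (if p \<ge> 0 then G p q - expand_sum 0 f p q - (\<Sum>n<N. \<Psi> n p q) else 0)" for p q
  have F: "G p q - expand_sum 0 f p q - (\<Sum>n<N. \<Psi> n p q) = F p q - (\<Sum>n<N. \<Phi> n p q)" for p q
  proof (cases "p \<ge> 0")
    case True
    then have "\<Phi> n p q = 0" for n by (auto simp: \<Phi>_def gbin_def)
    with True show ?thesis by (simp add: F_def)
  next
    case False
    then have P: "p = - int (nat (- p - 1)) - 1" by simp
    have "\<Psi> n p q = 0" for n using False by (auto simp: \<Psi>_def gbin_def)
    with False neg[of "nat (- p - 1)" q] show ?thesis unfolding P[symmetric] by (simp add: F_def)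
  qed
  obtain l where l: "\<And>p q. expand_sum l f p q = (\<Sum>i\<le>l. of_nat (l choose i) *\<^sub>C G (p - int (l - i)) (q - int i))"
    using assoc unfolding weak_associativity_def expand_sum_def f_def G_def by blast
  have "(mul_sum ^^ l) (expand_sum 0 f) = (mul_sum ^^ l) G"
    using l expand_sum_pow[of R f l, OF f0] unfolding binomial_sum_pow by (simp add: fun_eq_iff)
  \<comment> \<open>The exponent l serves weak associativity, and the extra N clears the poles of
    order n + 1 \<le> N when \<Phi> is exchanged for \<Psi>. The empty instance of
    \<open>mul_sum_pow_sum\<close> says that zero stays zero.\<close>
  then have GF: "(mul_sum ^^ (N + l)) (\<lambda>p q. G p q - expand_sum 0 f p q) = (\<lambda>_ _. 0)"
    by (simp add: funpow_add mul_sum_pow_diff[of l] mul_sum_pow_sum[of N "\<lambda>_ _ _. 0" "{}", simplified])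
  have \<Phi>\<Psi>: "(mul_sum ^^ (N + l)) (\<lambda>p q. \<Sum>n<N. \<Phi> n p q) = (mul_sum ^^ (N + l)) (\<lambda>p q. \<Sum>n<N. \<Psi> n p q)"
  proof -
    have "(mul_sum ^^ (N + l)) (\<Phi> n) = (mul_sum ^^ (N + l)) (\<Psi> n)" if "n < N" for n
      unfolding \<Phi>_def \<Psi>_def using that by (intro mul_sum_pow_expansions) simp
    then show ?thesis by (simp add: mul_sum_pow_sum)
  qed
  have "(mul_sum ^^ (N + l)) (\<lambda>p q. F p q - (\<Sum>n<N. \<Phi> n p q))
      = (\<lambda>p q. 0 - (mul_sum ^^ (N + l)) (\<lambda>p q. \<Sum>n<N. \<Psi> n p q) p q)"
    unfolding F[symmetric] mul_sum_pow_diff[of _ "\<lambda>p q. G p q - expand_sum 0 f p q"] GF ..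
  then have "(mul_sum ^^ (N + l)) F = (\<lambda>_ _. 0)"
    unfolding mul_sum_pow_diff \<Phi>\<Psi> by (simp add: fun_eq_iff)
  then have "F = (\<lambda>_ _. 0)"
    by (rule mul_sum_pow_eq_0) (simp add: F_def)
  then have "F (int p) q = 0" by simp
  then show ?thesis
    by (simp add: F_def \<Psi>_def gbin_nat f_def[abs_def] G_def g_def algebra_simps)
qed


section \<open>Exponential of the translation operator\<close>

text \<open>Divided powers satisfy D e_n = (n+1) e_(n+1). Applying D to the formula for n gives the
  terms of the next one with weights i and n+1-i, whose sum n+1 cancels.\<close>

lemma exp_derivation_mult:
  fixes D :: "'a::complex_comm_algebra \<Rightarrow> 'a"
  assumes D: "derivation D"
  defines "e \<equiv> \<lambda>n x. (1 / fact n) *\<^sub>C (D ^^ n) x"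
  shows "e n (a * b) = (\<Sum>i\<le>n. e i a * e (n - i) b)"
proof (induction n)
  case 0
  show ?case by (simp add: e_def scaleC_one)
next
  case (Suc n)
  note lin = clinearD[OF derivationD(1)[OF D]]
  have De: "D (e n x) = of_nat (Suc n) *\<^sub>C e (Suc n) x" for n x
    by (simp add: e_def lin scaleC_scaleC field_simps del: of_nat_Suc)
  have "of_nat (Suc n) *\<^sub>C e (Suc n) (a * b)
      = (\<Sum>i\<le>n. D (e i a) * e (n - i) b) + (\<Sum>i\<le>n. e i a * D (e (n - i) b))"
    by (simp only: De[symmetric] Suc.IH lin derivationD(2)[OF D] sum.distrib)
  also have "(\<Sum>i\<le>n. D (e i a) * e (n - i) b) = (\<Sum>i\<le>Suc n. of_nat i *\<^sub>C (e i a * e (Suc n - i) b))"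
    unfolding sum.atMost_Suc_shift by (simp add: De scaleC_mult_left del: of_nat_Suc)
  also have "(\<Sum>i\<le>n. e i a * D (e (n - i) b)) = (\<Sum>i\<le>n. of_nat (Suc n - i) *\<^sub>C (e i a * e (Suc n - i) b))"
    by (intro sum.cong refl) (simp add: De scaleC_mult_right Suc_diff_le del: of_nat_Suc)
  also have "\<dots> = (\<Sum>i\<le>Suc n. of_nat (Suc n - i) *\<^sub>C (e i a * e (Suc n - i) b))"
    by simp
  also have "(\<Sum>i\<le>Suc n. of_nat i *\<^sub>C (e i a * e (Suc n - i) b)) + \<dots>
      = of_nat (Suc n) *\<^sub>C (\<Sum>i\<le>Suc n. e i a * e (Suc n - i) b)"
    unfolding sum.distrib[symmetric] scaleC_add_left[symmetric] cvs.scale_sum_right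
    by (intro sum.cong refl) (simp flip: of_nat_add del: of_nat_Suc)
  finally have "(1 / of_nat (Suc n)) *\<^sub>C of_nat (Suc n) *\<^sub>C e (Suc n) (a * b)
      = (1 / of_nat (Suc n)) *\<^sub>C of_nat (Suc n) *\<^sub>C (\<Sum>i\<le>Suc n. e i a * e (Suc n - i) b)"
    by (rule arg_cong)
  moreover have "1 / of_nat (Suc n) * of_nat (Suc n) = (1 :: complex)"
    by (simp del: of_nat_Suc)
  ultimately show ?case by (simp only: scaleC_scaleC scaleC_one)
qed

text \<open>\<open>heis_exp a\<close> is \<open>e\<^sup>x\<^sup>L\<^sup>(\<^sup>-\<^sup>1\<^sup>) a\<close>.\<close>

definition heis_exp :: "'h::complex_vector heis \<Rightarrow> 'h heis fls"
  where "heis_exp a = Abs_fls (\<lambda>n. heis_Y a 1 n)"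

lemma heis_exp_nth: "heis_exp a $$ n = (if n \<ge> 0 then (1 / fact (nat n)) *\<^sub>C (heis_L ^^ nat n) a else 0)"
  unfolding heis_exp_def
  by (subst fls_nth_Abs_lower_bound[of 0]) (simp_all add: heis_Y_def)

lemma heis_Y_exp: "heis_Y a b n = heis_exp a $$ n * b"
  by (simp add: heis_Y_def heis_exp_nth scaleC_mult_left)

lemma clinear_heis_L_pow: "clinear (heis_L ^^ n)"
proof (induction n)
  case (Suc n)
  show ?case
    using clinear_compose[OF Suc derivationD(1)[OF heis_L(1)]] by (simp add: o_def)
qed (simp add: id_def clinear_id)

lemma heis_exp_hom: "alg_hom (heis_exp :: 'h::complex_vector heis \<Rightarrow> _)"
  unfolding alg_hom_def
proof (intro conjI allI)
  show "clinear (heis_exp :: 'h heis \<Rightarrow> _)"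
    by (rule clinearI; rule fls_eqI)
      (simp_all add: heis_exp_nth clinearD[OF clinear_heis_L_pow] scaleC_add_right scaleC_scaleC mult.commute)
  have "(heis_L ^^ n) (1 :: 'h heis) = (if n = 0 then 1 else 0)" for n
    by (induction n) (simp_all add: derivationD(3)[OF heis_L(1)] clinearD[OF derivationD(1)[OF heis_L(1)]])
  then show "heis_exp (1 :: 'h heis) = 1"
    by (intro fls_eqI) (auto simp: heis_exp_nth scaleC_one)
  fix a b :: "'h heis"
  show "heis_exp (a * b) = heis_exp a * heis_exp b"
  proof (rule fls_eqI)
    fix n
    have "(heis_exp a * heis_exp b) $$ n = (\<Sum>i\<in>{0..n}. heis_exp a $$ i * heis_exp b $$ (n - i))"
      by (rule fls_times_nth_superset[of 0 _ 0]) (simp_all add: heis_exp_nth)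
    also have "\<dots> = heis_exp (a * b) $$ n"
    proof (cases "n < 0")
      case False
      then obtain k where k: "n = int k" by (metis nonneg_int_cases not_le)
      have "{0..n} = int ` {..k}" by (auto simp: k image_iff) (metis nonneg_int_cases atMost_iff of_nat_le_iff)
      then have "(\<Sum>i\<in>{0..n}. heis_exp a $$ i * heis_exp b $$ (n - i))
          = (\<Sum>i\<le>k. heis_exp a $$ int i * heis_exp b $$ int (k - i))"
        by (simp add: sum.reindex k of_nat_diff)
      also have "\<dots> = heis_exp (a * b) $$ n"
        using exp_derivation_mult[OF heis_L(1), of k a b]
        by (simp add: heis_exp_nth k del: of_nat_diff)
      finally show ?thesis .
    qed (simp add: heis_exp_nth)
    finally show "heis_exp (a * b) $$ n = (heis_exp a * heis_exp b) $$ n" ..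
  qed
qed

text \<open>L(-1)^k contributes the factor (p+1)(p+2)...(p+k), which is k! times the binomial
  coefficient.\<close>

lemma heis_exp_gen:
  "heis_exp (heis_gen \<alpha> (Suc p)) $$ int k = of_nat ((p + k) choose k) *\<^sub>C heis_gen \<alpha> (Suc (p + k))"
proof -
  have "(heis_L ^^ k) (heis_gen \<alpha> (Suc p)) = (fact k * of_nat ((p + k) choose k)) *\<^sub>C heis_gen \<alpha> (Suc (p + k))"
  proof (induction k)
    case (Suc k)
    have "of_nat (Suc k) * of_nat ((p + Suc k) choose Suc k) = (of_nat ((p + k) choose k) * of_nat (Suc (p + k)) :: complex)"
      using Suc_times_binomial_eq[of "p + k" k] by (metis add_Suc_right of_nat_mult mult.commute)
    then have "fact k * of_nat ((p + k) choose k) * of_nat (Suc (p + k))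
        = (fact (Suc k) * of_nat ((p + Suc k) choose Suc k) :: complex)"
      by (simp add: mult.assoc)
    with Suc show ?case
      by (simp add: heis_L clinearD[OF derivationD(1)[OF heis_L(1)]] scaleC_scaleC del: of_nat_Suc fact_Suc)
  qed (simp add: scaleC_one)
  then show ?thesis by (simp add: heis_exp_nth scaleC_scaleC)
qed


section \<open>Heisenberg fields\<close>

definition field_fls :: "('v \<Rightarrow> 'w \<Rightarrow> 'w series) \<Rightarrow> 'v \<Rightarrow> 'w \<Rightarrow> 'w::zero fls"
  where "field_fls Y u w = Abs_fls (Y u w)"

lemma field_fls:
  fixes Y :: "'v::complex_vector \<Rightarrow> 'w::complex_comm_algebra \<Rightarrow> 'w series"
  assumes "vertex_operator_map UNIV UNIV Y"
  shows "field_fls Y u w $$ n = Y u w n" "cbilinear (field_fls Y)"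
proof -
  have Y: "\<exists>N. \<forall>n<N. Y u w n = 0" "clinear_on UNIV (\<lambda>w. Y u w n)" "clinear_on UNIV (\<lambda>u. Y u w n)" for u w n
    using assms unfolding vertex_operator_map_def by blast+
  show nth: "field_fls Y u w $$ n = Y u w n" for u w n
    unfolding field_fls_def using Y(1) by (metis fls_nth_Abs_lower_bound)
  show "cbilinear (field_fls Y)"
    unfolding cbilinear_def
    by (intro conjI allI clinearI fls_eqI) (use Y(2,3) in \<open>auto simp: nth clinear_on_def\<close>)
qed

section \<open>Annihilation operators and the recursion for fields\<close>

context
  fixes form :: "'h::complex_vector \<Rightarrow> 'h \<Rightarrow> complex"
  assumes form: "cbilinear form"
begin

definition ann :: "'h \<Rightarrow> nat \<Rightarrow> 'h heis \<Rightarrow> 'h heis"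
  where "ann \<alpha> n = heis_op form \<alpha> (int n)"

lemma ann_derivation: "derivation (ann \<alpha> n)"
  unfolding ann_def by (rule heis_op_derivation[OF form])

lemmas ann_linear = clinearD[OF derivationD(1)[OF ann_derivation]]

lemma ann_1 [simp]: "ann \<alpha> n 1 = 0"
  by (rule derivationD(3)[OF ann_derivation])

lemma ann_heis_gen: "ann \<alpha> n (heis_gen \<beta> (Suc p)) = (if n = Suc p then (of_nat n * form \<alpha> \<beta>) *\<^sub>C 1 else 0)"
  unfolding ann_def by (rule heis_op_derivation[OF form])

lemma ann_gen_mult:
  "ann \<alpha> n (heis_gen \<beta> (Suc p) * x)
    = (if n = Suc p then of_nat n * form \<alpha> \<beta> else 0) *\<^sub>C x + heis_gen \<beta> (Suc p) * ann \<alpha> n x"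
  by (simp add: derivationD(2)[OF ann_derivation] ann_heis_gen scaleC_mult_left)

lemma ann_commute: "ann \<alpha> n (ann \<beta> m x) = ann \<beta> m (ann \<alpha> n x)"
  by (induction x rule: heis_induct) (simp_all add: ann_linear ann_gen_mult)

text \<open>The coefficient of \<open>x\<^sub>0\<^sup>p x\<^sub>2\<^sup>-\<^sup>n\<^sup>-\<^sup>1\<^sup>-\<^sup>p\<close> in \<open>(x\<^sub>2 + x\<^sub>0)\<^sup>-\<^sup>n\<^sup>-\<^sup>1\<close>.\<close>

definition ann_coeff :: "nat \<Rightarrow> nat \<Rightarrow> complex"
  where "ann_coeff p n = of_int (- int (Suc n)) gchoose p"

text \<open>Shared by M(1), where \<open>\<kappa> = 1\<close>, and by the module \<open>Y_M\<close>,
  where \<open>\<kappa> = 0\<close> because \<alpha>(-1) has no creation part. The commutator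
  formula is a premise for the given \<open>u\<close> alone, since it is itself proved by an
  induction that uses this recursion.\<close>

lemma field_iterate:
  assumes Y: "vertex_operator_map UNIV UNIV Y"
    and assoc: "weak_associativity Y0 Y (heis_gen \<alpha> 1) u w"
    and Y0: "Y0 (heis_gen \<alpha> 1) u (int p) = heis_gen \<alpha> (Suc p) * u"
    and minus: "\<And>n v. Y (heis_gen \<alpha> 1) v (- int n - 1) = ann \<alpha> n v"
    and plus: "\<And>n v. Y (heis_gen \<alpha> 1) v (int n) = \<kappa> *\<^sub>C (heis_gen \<alpha> (Suc n) * v)"
    and comm: "\<And>n. fls_map (ann \<alpha> n) (field_fls Y u w) = field_fls Y u (ann \<alpha> n w)
        + (\<Sum>i\<le>n. of_nat (n choose i) *\<^sub>C
            fls_shift (int i - int n) (field_fls Y (Y0 (heis_gen \<alpha> 1) u (- int i - 1)) w))"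
    and N: "\<And>n. n \<ge> N \<Longrightarrow> ann \<alpha> n w = 0"
  shows "field_fls Y (heis_gen \<alpha> (Suc p) * u) w =
    \<kappa> *\<^sub>C (heis_exp (heis_gen \<alpha> (Suc p)) * field_fls Y u w)
    + (\<Sum>n<N. ann_coeff p n *\<^sub>C fls_shift (int (Suc n) + int p) (field_fls Y u (ann \<alpha> n w)))"
proof (rule fls_eqI)
  fix q
  let ?a = "heis_gen \<alpha> 1"
  note nth = field_fls(1)[OF Y]
  obtain R where R: "\<And>r. r < R \<Longrightarrow> Y u w r = 0"
    using Y unfolding vertex_operator_map_def by blast
  define J where "J = nat (q - R)"
  have comm': "Y ?a (Y u w r) (- int n - 1) = Y u (Y ?a w (- int n - 1)) r
        + (\<Sum>i\<le>n. of_nat (n choose i) *\<^sub>C Y (Y0 ?a u (- int i - 1)) w (r - int n + int i))" for n r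
    using arg_cong[OF comm, of "\<lambda>f. f $$ r" n]
    by (simp add: minus fls_sum_nth nth fls_map_clinear_nth[OF derivationD(1)[OF ann_derivation]]
        algebra_simps del: One_nat_def)
  have "field_fls Y (heis_gen \<alpha> (Suc p) * u) w $$ q
      = expand_sum 0 (\<lambda>k r. Y ?a (Y u w r) k) (int p) q
      + (\<Sum>n<N. (of_int (- int (Suc n)) gchoose p) *\<^sub>C Y u (Y ?a w (- int n - 1)) (q + int (Suc n) + int p))"
    unfolding nth Y0[symmetric] by (rule iterate_formula[OF Y assoc comm']) (simp_all add: minus N del: One_nat_def)
  also have "expand_sum 0 (\<lambda>k r. Y ?a (Y u w r) k) (int p) q
      = (\<Sum>j\<le>J. (of_int (int p + int j) gchoose j) *\<^sub>C Y ?a (Y u w (q - int j)) (int p + int j - int 0))"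
    by (rule expand_sum_finite[of R])
      (simp_all add: R J_def clinearD[OF clinear_compose[OF cbilinearD(1)[OF field_fls(2)[OF Y]] clinear_fls_nth], unfolded nth])
  \<comment> \<open>Only creation modes occur at nonnegative powers of x0, and their binomial
    factors are those of the exponential series of \<alpha>(-p-1).\<close>
  also have "\<dots> = \<kappa> *\<^sub>C (\<Sum>j\<le>J. heis_exp (heis_gen \<alpha> (Suc p)) $$ int j * field_fls Y u w $$ (q - int j))"
    unfolding cvs.scale_sum_right
  proof (intro sum.cong refl)
    fix j
    have "(of_int (int p + int j) :: complex) gchoose j = of_nat ((p + j) choose j)"
      "int p + int j - int 0 = int (p + j)"
      by (simp_all add: binomial_gbinomial)
    then show "(of_int (int p + int j) gchoose j) *\<^sub>C Y ?a (Y u w (q - int j)) (int p + int j - int 0)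
        = \<kappa> *\<^sub>C (heis_exp (heis_gen \<alpha> (Suc p)) $$ int j * field_fls Y u w $$ (q - int j))"
      by (simp only: plus heis_exp_gen nth scaleC_mult_left scaleC_scaleC mult.commute[of _ \<kappa>])
  qed
  also have "(\<Sum>j\<le>J. heis_exp (heis_gen \<alpha> (Suc p)) $$ int j * field_fls Y u w $$ (q - int j))
      = (\<Sum>j\<in>int ` {..J}. heis_exp (heis_gen \<alpha> (Suc p)) $$ j * field_fls Y u w $$ (q - j))"
    by (simp add: sum.reindex)
  also have "\<dots> = (heis_exp (heis_gen \<alpha> (Suc p)) * field_fls Y u w) $$ q"
  proof (rule fls_times_nth_superset[of 0 _ R, symmetric])
    show "{0..q - R} \<subseteq> int ` {..J}"
    proof
      fix i assume "i \<in> {0..q - R}"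
      then have "i = int (nat i)" "nat i \<le> J" by (auto simp: J_def)
      then show "i \<in> int ` {..J}" by blast
    qed
  qed (simp_all add: heis_exp_nth R nth)
  finally show "field_fls Y (heis_gen \<alpha> (Suc p) * u) w $$ q = (\<kappa> *\<^sub>C (heis_exp (heis_gen \<alpha> (Suc p)) * field_fls Y u w)
    + (\<Sum>n<N. ann_coeff p n *\<^sub>C fls_shift (int (Suc n) + int p) (field_fls Y u (ann \<alpha> n w)))) $$ q"
    by (simp add: fls_sum_nth nth minus ann_coeff_def add.assoc del: One_nat_def)
qed

text \<open>Polynomial degree at most d in the generators, given by closure rules so that no normal
  form of an element has to be chosen.\<close>

inductive heis_deg :: "nat \<Rightarrow> 'h heis \<Rightarrow> bool" where
  one: "heis_deg d 1"
| add: "heis_deg d x \<Longrightarrow> heis_deg d y \<Longrightarrow> heis_deg d (x + y)"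
| scale: "heis_deg d x \<Longrightarrow> heis_deg d (c *\<^sub>C x)"
| gen: "heis_deg d x \<Longrightarrow> heis_deg (Suc d) (heis_gen \<alpha> (Suc p) * x)"
| up: "heis_deg d x \<Longrightarrow> heis_deg (Suc d) x"

lemma heis_deg_mono: "heis_deg d x \<Longrightarrow> d \<le> e \<Longrightarrow> heis_deg e x"
  by (induction e rule: nat_induct) (auto simp: le_Suc_eq intro: heis_deg.up)

lemma heis_deg_0: "heis_deg d 0"
  using heis_deg.scale[OF heis_deg.one, of _ 0] by simp

lemma heis_deg_ex: "\<exists>d. heis_deg d x"
proof (induction x rule: heis_induct)
  case (add x y)
  then obtain d e where "heis_deg d x" "heis_deg e y" by blast
  then have "heis_deg (max d e) x" "heis_deg (max d e) y" by (auto elim: heis_deg_mono)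
  then show ?case by (blast intro: heis_deg.add)
qed (blast intro: heis_deg.intros)+

lemma heis_deg_ann: "heis_deg d x \<Longrightarrow> heis_deg d (ann \<alpha> n x)"
  by (induction rule: heis_deg.induct)
    (simp_all add: ann_linear ann_gen_mult heis_deg_0 heis_deg.intros(2-))

text \<open>\<alpha>(n) pairs only with \<beta>(-n), which sits at x^(n-p-1). The factor n times
  (n-1 over p) is rewritten as p+1 times (n over p+1) to match the term i = p+1 of the commutator
  formula.\<close>

lemma ann_heis_exp:
  "fls_map (ann \<alpha> n) (heis_exp (heis_gen \<beta> (Suc p)))
    = (if p < n then (of_nat (n choose Suc p) * (of_nat (Suc p) * form \<alpha> \<beta>)) *\<^sub>C fls_shift (int (Suc p) - int n) 1 else 0)"
proof (rule fls_eqI)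
  fix k
  note nth = fls_map_clinear_nth[OF derivationD(1)[OF ann_derivation]]
  have coeff: "of_nat (Suc (p + j) choose Suc p) * (of_nat (Suc p) * form \<alpha> \<beta>)
      = of_nat ((p + j) choose j) * (of_nat (Suc (p + j)) * form \<alpha> \<beta>)" for j
  proof -
    have "(Suc (p + j) choose Suc p) * Suc p = ((p + j) choose j) * Suc (p + j)"
      using Suc_times_binomial_eq[of "p + j" p] binomial_symmetric[of p "p + j"]
      by (simp del: binomial_Suc_Suc add: mult.commute)
    then have "of_nat (Suc (p + j) choose Suc p) * of_nat (Suc p)
        = (of_nat ((p + j) choose j) * of_nat (Suc (p + j)) :: complex)"
      by (metis of_nat_mult)
    then show ?thesis by (simp only: mult.assoc[symmetric])
  qed
  show "fls_map (ann \<alpha> n) (heis_exp (heis_gen \<beta> (Suc p))) $$ k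
    = (if p < n then (of_nat (n choose Suc p) * (of_nat (Suc p) * form \<alpha> \<beta>)) *\<^sub>C fls_shift (int (Suc p) - int n) 1 else 0) $$ k"
  proof (cases k)
    case (nonneg j)
    show ?thesis
    proof (cases "n = Suc (p + j)")
      case True
      then show ?thesis
        by (simp add: nth nonneg heis_exp_gen ann_linear ann_heis_gen scaleC_scaleC coeff
            del: of_nat_Suc binomial_Suc_Suc)
    qed (auto simp: nth nonneg heis_exp_gen ann_linear ann_heis_gen)
  qed (auto simp: nth heis_exp_nth ann_linear)
qed

text \<open>The commutator formula is needed for \<open>\<alpha>(i)u\<close>, \<open>i \<ge> 0\<close>, in order to prove it for \<open>\<gamma>(-p-1)u\<close>;
  hence the induction over the degree filtration, which is stable under these operators.\<close>

lemma gen_modes: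
  assumes "\<And>\<alpha> v k. Y (heis_gen \<alpha> 1) v k = heis_plus form \<alpha> v k + heis_minus form \<alpha> v k"
  shows "Y (heis_gen \<alpha> 1) v (int p) = heis_gen \<alpha> (Suc p) * v"
    "Y (heis_gen \<alpha> 1) v (- int p - 1) = ann \<alpha> p v"
  by (simp_all add: assms heis_plus_def heis_minus_def heis_op_def ann_def nat_add_distrib del: One_nat_def)

text \<open>Read off from the truncation of Y(\<alpha>(-1), x)v rather than from the generators that
  occur in v.\<close>

lemma ann_finite:
  assumes Y: "vertex_operator_map UNIV UNIV Y"
    and minus: "\<And>n v. Y (heis_gen \<alpha> 1) v (- int n - 1) = ann \<alpha> n v"
  shows "\<exists>N. \<forall>n\<ge>N. ann \<alpha> n v = 0"
proof -
  obtain R where R: "\<And>r. r < R \<Longrightarrow> Y (heis_gen \<alpha> 1) v r = 0"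
    using Y unfolding vertex_operator_map_def by blast
  have "ann \<alpha> n v = 0" if "n \<ge> nat (- R)" for n
    unfolding minus[symmetric] by (rule R) (use that in linarith)
  then show ?thesis by blast
qed

lemma M1_commutator:
  assumes va: "nonlocal_vertex_algebra UNIV Y 1"
    and gen: "\<And>\<alpha> v k. Y (heis_gen \<alpha> 1) v k = heis_plus form \<alpha> v k + heis_minus form \<alpha> v k"
  shows "fls_map (ann \<alpha> n) (field_fls Y u w) = field_fls Y u (ann \<alpha> n w)
    + (\<Sum>i\<le>n. of_nat (n choose i) *\<^sub>C fls_shift (int i - int n) (field_fls Y (ann \<alpha> i u) w))"
proof -
  note modes = gen_modes[OF gen]
  have Y: "vertex_operator_map UNIV UNIV Y" and vac: "Y 1 v k = (if k = 0 then v else 0)"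
    and assoc: "weak_associativity Y Y x y z" for v k x y z
    using va by (auto simp: nonlocal_vertex_algebra_def)
  note F = field_fls[OF Y]
  note F_linear = clinearD[OF cbilinearD(1)[OF F(2)]] clinearD[OF cbilinearD(2)[OF F(2)]]
  note map_linear = clinearD[OF clinear_fls_map[OF derivationD(1)[OF ann_derivation]]]
  note shift_linear = clinearD[OF clinear_fls_shift]
  define Q where "Q u \<longleftrightarrow> (\<forall>\<alpha> n w. fls_map (ann \<alpha> n) (field_fls Y u w) = field_fls Y u (ann \<alpha> n w)
    + (\<Sum>i\<le>n. of_nat (n choose i) *\<^sub>C fls_shift (int i - int n) (field_fls Y (ann \<alpha> i u) w)))" for u
  have Q_gen: "Q (heis_gen \<gamma> (Suc p) * x)" if Q: "Q x" "\<And>\<alpha> i. Q (ann \<alpha> i x)" for \<gamma> p x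
    unfolding Q_def
  proof (intro allI)
    fix \<alpha> n w
    let ?E = "heis_exp (heis_gen \<gamma> (Suc p))"
    let ?s = "\<lambda>m. fls_shift (int (Suc m) + int p)"
    obtain N where N: "\<And>m. m \<ge> N \<Longrightarrow> ann \<gamma> m w = 0"
      using ann_finite[where Y = Y, OF Y modes(2)] by blast
    have R: "field_fls Y (heis_gen \<gamma> (Suc p) * y) v = ?E * field_fls Y y v
        + (\<Sum>m<N. ann_coeff p m *\<^sub>C ?s m (field_fls Y y (ann \<gamma> m v)))"
      if "Q y" "\<And>m. m \<ge> N \<Longrightarrow> ann \<gamma> m v = 0" for y v
      using field_iterate[OF Y assoc modes(1) modes(2), of \<gamma> 1 y v N p] that
      by (simp add: modes Q_def scaleC_one del: One_nat_def)
    have Q': "fls_map (ann \<alpha> n) (field_fls Y x v) = field_fls Y x (ann \<alpha> n v)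
        + (\<Sum>i\<le>n. of_nat (n choose i) *\<^sub>C fls_shift (int i - int n) (field_fls Y (ann \<alpha> i x) v))" for v
      using Q(1) by (simp add: Q_def)
    \<comment> \<open>\<open>?A\<close> is the contraction of \<alpha> with \<gamma>. It arises on
      one side from \<alpha>(n) hitting the factor \<open>?E\<close>, on the other from
      \<alpha>(p+1) hitting \<gamma>(-p-1) in \<gamma>(-p-1)x.\<close>
    let ?A = "if p < n then (of_nat (n choose Suc p) * (of_nat (Suc p) * form \<alpha> \<gamma>)) *\<^sub>C
        fls_shift (int (Suc p) - int n) (field_fls Y x w) else 0"
    have A: "(\<Sum>i\<le>n. of_nat (n choose i) *\<^sub>C fls_shift (int i - int n)
        (field_fls Y ((if i = Suc p then of_nat i * form \<alpha> \<gamma> else 0) *\<^sub>C x) w)) = ?A"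
    proof -
      have "(\<Sum>i\<le>n. of_nat (n choose i) *\<^sub>C fls_shift (int i - int n)
          (field_fls Y ((if i = Suc p then of_nat i * form \<alpha> \<gamma> else 0) *\<^sub>C x) w))
        = (\<Sum>i\<le>n. if i = Suc p then (of_nat (n choose Suc p) * (of_nat (Suc p) * form \<alpha> \<gamma>)) *\<^sub>C
        fls_shift (int (Suc p) - int n) (field_fls Y x w) else 0)"
        by (intro sum.cong refl) (simp add: F_linear shift_linear scaleC_scaleC del: of_nat_Suc)
      then show ?thesis by (simp del: of_nat_Suc)
    qed
    have "fls_map (ann \<alpha> n) (field_fls Y (heis_gen \<gamma> (Suc p) * x) w)
      = ?A + ?E * fls_map (ann \<alpha> n) (field_fls Y x w)
        + (\<Sum>m<N. ann_coeff p m *\<^sub>C ?s m (fls_map (ann \<alpha> n) (field_fls Y x (ann \<gamma> m w))))"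
      by (simp add: R[OF Q(1) N] map_linear derivationD(2)[OF fls_map_derivation[OF ann_derivation]]
          ann_heis_exp fls_shifted_times_simps scaleC_mult_left
          fls_map_shift[OF derivationD(1)[OF ann_derivation]] del: of_nat_Suc)
    also have "\<dots> = field_fls Y (heis_gen \<gamma> (Suc p) * x) (ann \<alpha> n w) + ?A
        + (\<Sum>i\<le>n. of_nat (n choose i) *\<^sub>C fls_shift (int i - int n)
            (?E * field_fls Y (ann \<alpha> i x) w
             + (\<Sum>m<N. ann_coeff p m *\<^sub>C ?s m (field_fls Y (ann \<alpha> i x) (ann \<gamma> m w)))))"
    proof -
      have "?E * (\<Sum>i\<le>n. of_nat (n choose i) *\<^sub>C fls_shift (int i - int n) (field_fls Y (ann \<alpha> i x) w))
          = (\<Sum>i\<le>n. of_nat (n choose i) *\<^sub>C fls_shift (int i - int n) (?E * field_fls Y (ann \<alpha> i x) w))"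
        by (simp add: sum_distrib_left scaleC_mult_right fls_shifted_times_simps)
      moreover have "(\<Sum>m<N. ann_coeff p m *\<^sub>C ?s m (\<Sum>i\<le>n. of_nat (n choose i) *\<^sub>C
            fls_shift (int i - int n) (field_fls Y (ann \<alpha> i x) (ann \<gamma> m w))))
          = (\<Sum>i\<le>n. of_nat (n choose i) *\<^sub>C fls_shift (int i - int n)
              (\<Sum>m<N. ann_coeff p m *\<^sub>C ?s m (field_fls Y (ann \<alpha> i x) (ann \<gamma> m w))))"
        unfolding shift_linear cvs.scale_sum_right
        by (subst sum.swap) (intro sum.cong refl,
            simp only: scaleC_scaleC fls_shift_fls_shift mult.commute add.commute)
      \<comment> \<open>The bound N for w also serves \<alpha>(n)w, because annihilation modes
        commute.\<close>
      moreover have "field_fls Y (heis_gen \<gamma> (Suc p) * x) (ann \<alpha> n w) = ?E * field_fls Y x (ann \<alpha> n w)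
          + (\<Sum>m<N. ann_coeff p m *\<^sub>C ?s m (field_fls Y x (ann \<alpha> n (ann \<gamma> m w))))"
        using R[OF Q(1), of "ann \<alpha> n w"] N by (simp add: ann_commute[of \<gamma> _ \<alpha>] ann_linear)
      ultimately show ?thesis
        by (simp only: Q' distrib_left shift_linear(1) scaleC_add_right sum.distrib add_ac)
    qed
    also have "\<dots> = field_fls Y (heis_gen \<gamma> (Suc p) * x) (ann \<alpha> n w)
        + (\<Sum>i\<le>n. of_nat (n choose i) *\<^sub>C fls_shift (int i - int n)
            (field_fls Y (ann \<alpha> i (heis_gen \<gamma> (Suc p) * x)) w))"
      by (simp only: R[OF Q(2) N, symmetric] A[symmetric] ann_gen_mult F_linear shift_linear
          scaleC_add_right sum.distrib add.assoc)
    finally show "fls_map (ann \<alpha> n) (field_fls Y (heis_gen \<gamma> (Suc p) * x) w)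
      = field_fls Y (heis_gen \<gamma> (Suc p) * x) (ann \<alpha> n w)
        + (\<Sum>i\<le>n. of_nat (n choose i) *\<^sub>C fls_shift (int i - int n)
            (field_fls Y (ann \<alpha> i (heis_gen \<gamma> (Suc p) * x)) w))" .
  qed
  \<comment> \<open>When \<gamma>(-p-1)x is treated in degree d+1, the inner rule induction supplies
    \<open>Q x\<close> and the outer one supplies \<open>Q\<close> for every \<alpha>(i)x, whose
    degree is at most d.\<close>
  have "\<forall>x. heis_deg d x \<longrightarrow> Q x" for d
  proof (induction d rule: less_induct)
    case (less d)
    have "Q x" if "heis_deg d x" "\<forall>e<d. \<forall>y. heis_deg e y \<longrightarrow> Q y" for x
      using that
    proof (induction rule: heis_deg.induct)
      case (one d)
      have "field_fls Y 1 v = fls_const v" for v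
        by (rule fls_eqI) (simp add: F vac)
      then show ?case
        by (simp add: Q_def F_linear fls_map_const[OF derivationD(1)[OF ann_derivation]])
    next
      case (add d x y)
      then show ?case
        by (simp add: Q_def F_linear map_linear ann_linear shift_linear scaleC_add_right sum.distrib algebra_simps)
    next
      case (scale d x c)
      then show ?case
        by (simp add: Q_def F_linear map_linear ann_linear shift_linear scaleC_add_right
            cvs.scale_sum_right scaleC_scaleC mult.commute)
    next
      case (gen d x \<gamma> p)
      then show ?case by (intro Q_gen) (auto intro: heis_deg_ann)
    qed auto
    with less show ?case by blast
  qed
  then have "Q u" using heis_deg_ex by blast
  then show ?thesis by (simp add: Q_def)
qed

lemma M1_iterate:
  assumes va: "nonlocal_vertex_algebra UNIV Y 1"
    and gen: "\<And>\<alpha> v k. Y (heis_gen \<alpha> 1) v k = heis_plus form \<alpha> v k + heis_minus form \<alpha> v k"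
    and N: "\<And>n. n \<ge> N \<Longrightarrow> ann \<alpha> n w = 0"
  shows "field_fls Y (heis_gen \<alpha> (Suc p) * u) w = heis_exp (heis_gen \<alpha> (Suc p)) * field_fls Y u w
    + (\<Sum>n<N. ann_coeff p n *\<^sub>C fls_shift (int (Suc n) + int p) (field_fls Y u (ann \<alpha> n w)))"
proof -
  note modes = gen_modes[OF gen]
  have Y: "vertex_operator_map UNIV UNIV Y" and assoc: "weak_associativity Y Y x y z" for x y z
    using va by (auto simp: nonlocal_vertex_algebra_def)
  show ?thesis
    using field_iterate[OF Y assoc modes(1) modes(2), of \<alpha> 1 u w N p] N
    by (simp add: modes M1_commutator[OF va gen] scaleC_one del: One_nat_def)
qed

section \<open>The module structure by annihilation operators\<close>

context
  fixes Y_M :: "'h heis \<Rightarrow> 'h heis \<Rightarrow> 'h heis series"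
  assumes module: "va_module UNIV heis_Y 1 UNIV Y_M"
    and Y_M_gen: "\<And>\<alpha> v. Y_M (heis_gen \<alpha> 1) v = heis_minus form \<alpha> v"
begin

lemma Y_M_vertex_operator_map: "vertex_operator_map UNIV UNIV Y_M"
  using module by (simp add: va_module_def)

lemma Y_M_modes:
  "Y_M (heis_gen \<alpha> 1) v (int n) = 0" "Y_M (heis_gen \<alpha> 1) v (- int n - 1) = ann \<alpha> n v"
  by (simp_all add: Y_M_gen heis_minus_def ann_def del: One_nat_def)

lemma Y_M_vacuum: "field_fls Y_M 1 v = fls_const v"
  using module by (intro fls_eqI) (simp add: va_module_def field_fls(1)[OF Y_M_vertex_operator_map])

lemma Y_M_linear:
  "clinear (field_fls Y_M u)" "clinear (\<lambda>u. field_fls Y_M u v)"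
  using cbilinearD[OF field_fls(2)[OF Y_M_vertex_operator_map]] by blast+

lemma ann_finite_M: "\<exists>N. \<forall>n\<ge>N. ann \<alpha> n v = 0"
  by (rule ann_finite[OF Y_M_vertex_operator_map Y_M_modes(2)])

text \<open>In \<open>heis_Y\<close> the series Y(\<alpha>(-1), x)u has no negative powers, so the
  correction terms of the commutator formula vanish and \<alpha>(n) simply commutes with Y_M(u, x).
  That commutation is a premise because \<open>M_commutator\<close> is derived from this recursion
  by induction.\<close>

lemma M_iterate_aux:
  assumes comm: "\<And>n v. fls_map (ann \<alpha> n) (field_fls Y_M u v) = field_fls Y_M u (ann \<alpha> n v)"
    and N: "\<And>n. n \<ge> N \<Longrightarrow> ann \<alpha> n v = 0"
  shows "field_fls Y_M (heis_gen \<alpha> (Suc p) * u) v =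
    (\<Sum>n<N. ann_coeff p n *\<^sub>C fls_shift (int (Suc n) + int p) (field_fls Y_M u (ann \<alpha> n v)))"
proof -
  have assoc: "weak_associativity heis_Y Y_M x y z" for x y z
    using module by (simp add: va_module_def)
  have Y0: "heis_Y (heis_gen \<alpha> 1) u (int k) = heis_gen \<alpha> (Suc k) * u" for k
    using heis_exp_gen[of \<alpha> 0 k] by (simp add: heis_Y_exp scaleC_one)
  have "heis_Y (heis_gen \<alpha> 1) u (- int i - 1) = 0" for i
    by (simp add: heis_Y_def)
  then show ?thesis
    using field_iterate[OF Y_M_vertex_operator_map assoc Y0[of p] Y_M_modes(2), where \<kappa> = 0 and w = v and N = N] N
    by (simp add: comm Y_M_modes clinearD[OF Y_M_linear(2)] clinearD[OF clinear_fls_shift] del: One_nat_def)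
qed

lemma M_commutator: "fls_map (ann \<alpha> n) (field_fls Y_M u v) = field_fls Y_M u (ann \<alpha> n v)"
proof (induction u arbitrary: \<alpha> n v rule: heis_induct)
  case one
  show ?case by (simp add: Y_M_vacuum fls_map_const[OF derivationD(1)[OF ann_derivation]])
next
  case (gen \<beta> p x)
  obtain N where N: "\<And>m. m \<ge> N \<Longrightarrow> ann \<beta> m v = 0"
    using ann_finite_M by blast
  then have N': "\<And>m. m \<ge> N \<Longrightarrow> ann \<beta> m (ann \<alpha> n v) = 0"
    by (simp add: ann_commute[of \<beta>] ann_linear)
  show ?case
    by (simp only: M_iterate_aux[OF gen N] M_iterate_aux[OF gen N'] gen ann_commute[of \<beta> _ \<alpha>]
        clinearD[OF clinear_fls_map[OF derivationD(1)[OF ann_derivation]]]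
        fls_map_shift[OF derivationD(1)[OF ann_derivation]])
qed (simp_all add: clinearD[OF Y_M_linear(2)] clinearD[OF clinear_fls_map[OF derivationD(1)[OF ann_derivation]]])

lemmas M_iterate = M_iterate_aux[OF M_commutator]

end

end


section \<open>The smash product\<close>

text \<open>The three truncations bound both i and j, so the sum over all pairs, in the form used by
  \<open>smash_Y\<close>, has finite support.\<close>

lemma fls_triple_product_nth:
  fixes f g h :: "'a::comm_ring_1 fls"
  shows "(f * g * h) $$ n = Sum_any (\<lambda>(i, j). f $$ i * g $$ j * h $$ (n - i - j))"
proof -
  define a b c where "a = fls_subdegree f" and "b = fls_subdegree g" and "c = fls_subdegree h"
  have zero: "f $$ i = 0 \<or> g $$ j = 0 \<or> h $$ k = 0" if "i < a \<or> j < b \<or> k < c" for i j k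
    using that by (auto simp: a_def b_def c_def)
  have gh: "(g * h) $$ k = 0" if "k < b + c" for k
    using that unfolding b_def c_def by (rule fls_times_nth_eq0)
  have "(f * g * h) $$ n = (\<Sum>i\<in>{a..n - b - c}. f $$ i * (g * h) $$ (n - i))"
    unfolding mult.assoc
    by (rule fls_times_nth_superset[of a _ "b + c"]) (auto simp: a_def gh)
  also have "\<dots> = (\<Sum>i\<in>{a..n - b - c}. \<Sum>j\<in>{b..n - a - c}. f $$ i * g $$ j * h $$ (n - i - j))"
    unfolding mult.assoc sum_distrib_left[symmetric]
    by (intro sum.cong refl arg_cong2[of _ _ _ _ "(*)"] fls_times_nth_superset[of b _ c])
      (auto simp: b_def c_def)
  also have "\<dots> = (\<Sum>(i, j)\<in>{a..n - b - c} \<times> {b..n - a - c}. f $$ i * g $$ j * h $$ (n - i - j))"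
    by (simp add: sum.cartesian_product)
  also have "\<dots> = Sum_any (\<lambda>(i, j). f $$ i * g $$ j * h $$ (n - i - j))"
  proof (rule Sum_any.expand_superset[symmetric])
    show "{x. (case x of (i, j) \<Rightarrow> f $$ i * g $$ j * h $$ (n - i - j)) \<noteq> 0} \<subseteq> {a..n - b - c} \<times> {b..n - a - c}"
    proof clarify
      fix i j assume "f $$ i * g $$ j * h $$ (n - i - j) \<noteq> 0"
      then have "\<not> (i < a \<or> j < b \<or> n - i - j < c)" using zero[of i j "n - i - j"] by auto
      then show "i \<in> {a..n - b - c} \<and> j \<in> {b..n - a - c}" by auto
    qed
  qed simp
  finally show ?thesis .
qed

abbreviation left_fls :: "'a::complex_comm_algebra fls \<Rightarrow> ('a, 'b::complex_comm_algebra) tensor fls"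
  where "left_fls \<equiv> fls_map (\<lambda>a. a \<otimes>\<^sub>C 1)"

abbreviation right_fls :: "'b::complex_comm_algebra fls \<Rightarrow> ('a::complex_comm_algebra, 'b) tensor fls"
  where "right_fls \<equiv> fls_map (\<lambda>b. 1 \<otimes>\<^sub>C b)"

lemmas tensor_elem_linear = clinearD[OF cbilinearD(1)[OF cbilinear_tensor_elem]]
  clinearD[OF cbilinearD(2)[OF cbilinear_tensor_elem]]

lemma left_right_fls_linear: "clinear left_fls" "clinear right_fls"
  by (intro clinear_fls_map cbilinearD[OF cbilinear_tensor_elem])+

lemma left_right_fls_mult:
  "left_fls (f * g) = left_fls f * left_fls g" "right_fls (f * g) = right_fls f * right_fls g"
  by (intro fls_map_mult cbilinearD[OF cbilinear_tensor_elem] tensor_elem_left_mult)+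

context
  fixes form :: "'h::complex_vector \<Rightarrow> 'h \<Rightarrow> complex"
    and Y_M :: "'h heis \<Rightarrow> 'h heis \<Rightarrow> 'h heis series"
  assumes form: "cbilinear form"
    and module: "va_module UNIV heis_Y 1 UNIV Y_M"
    and Y_M_gen: "\<And>\<alpha> v. Y_M (heis_gen \<alpha> 1) v = heis_minus form \<alpha> v"
begin

text \<open>Placing the two tensor factors in commuting series over the tensor algebra turns the
  convolution in \<open>smash_Y\<close> into an ordinary product.\<close>

definition smash_core :: "'h heis \<Rightarrow> 'h heis \<Rightarrow> 'h heis \<Rightarrow> 'h heis \<Rightarrow> 'h heis \<Rightarrow> ('h heis, 'h heis) tensor fls"
  where "smash_core u v k h1 h2 =
    left_fls (heis_exp u) * left_fls (field_fls Y_M h1 v) * (right_fls (heis_exp h2) * fls_const (1 \<otimes>\<^sub>C k))"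

lemma smash_core_nth:
  "smash_core u v k h1 h2 $$ n =
    Sum_any (\<lambda>(i, j). heis_Y u (Y_M h1 v j) i \<otimes>\<^sub>C heis_Y h2 k (n - i - j))"
  unfolding smash_core_def fls_triple_product_nth
  by (simp add: cbilinearD[OF cbilinear_tensor_elem] tensor_mult heis_Y_exp
      field_fls(1)[OF Y_M_vertex_operator_map[OF form module Y_M_gen]] cong: if_cong)

lemma smash_core_linear:
  "clinear (\<lambda>u. smash_core u v k h1 h2)" "clinear (\<lambda>v. smash_core u v k h1 h2)"
  "clinear (\<lambda>k. smash_core u v k h1 h2)" "cbilinear (smash_core u v k)"
  unfolding smash_core_def cbilinear_def
  by (intro conjI allI clinear_mult_left clinear_mult_right
      clinear_compose[OF _ left_right_fls_linear(1)] clinear_compose[OF _ left_right_fls_linear(2)]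
      clinear_compose[OF _ clinear_fls_const] cbilinearD[OF cbilinear_tensor_elem] alg_homD(1)[OF heis_exp_hom]
      Y_M_linear[OF form module Y_M_gen])+

text \<open>The last argument is an arbitrary tensor in place of a coproduct, so that multiplication
  by \<alpha>(-m) \<otimes> 1 and by 1 \<otimes> \<alpha>(-m) can be studied separately.\<close>

definition smash_inner :: "'h heis \<Rightarrow> 'h heis \<Rightarrow> 'h heis \<Rightarrow> ('h heis, 'h heis) tensor \<Rightarrow> ('h heis, 'h heis) tensor fls"
  where "smash_inner u v k x = tensor_lift (smash_core u v k) x"

lemma smash_inner_elem: "smash_inner u v k (a \<otimes>\<^sub>C b) = smash_core u v k a b"
  unfolding smash_inner_def by (rule tensor_lift(2)[OF smash_core_linear(4)])

lemma smash_inner_linear: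
  "clinear (\<lambda>u. smash_inner u v k x)" "clinear (\<lambda>v. smash_inner u v k x)"
  "clinear (\<lambda>k. smash_inner u v k x)" "clinear (smash_inner u v k)"
  unfolding smash_inner_def
  by (intro clinear_tensor_lift_param tensor_lift(1) smash_core_linear)+

definition smash_fls :: "('h heis, 'h heis) tensor \<Rightarrow> ('h heis, 'h heis) tensor \<Rightarrow> ('h heis, 'h heis) tensor fls"
  where "smash_fls s t = tensor_lift (\<lambda>u h. tensor_lift (\<lambda>v k. smash_inner u v k (heis_Delta h)) t) s"

lemma smash_inner_Delta_bilinear: "cbilinear (\<lambda>v k. smash_inner u v k (heis_Delta h))"
  unfolding cbilinear_def by (intro conjI allI smash_inner_linear)

lemma smash_outer_bilinear:
  "cbilinear (\<lambda>u h. tensor_lift (\<lambda>v k. smash_inner u v k (heis_Delta h)) t)"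
  unfolding cbilinear_def
  by (intro conjI allI clinear_tensor_lift_param smash_inner_Delta_bilinear smash_inner_linear
      clinear_compose[OF alg_homD(1)[OF heis_Delta(1)] smash_inner_linear(4)])

lemma smash_fls_elem: "smash_fls (u \<otimes>\<^sub>C h) (v \<otimes>\<^sub>C k) = smash_inner u v k (heis_Delta h)"
  unfolding smash_fls_def tensor_lift(2)[OF smash_outer_bilinear]
  by (rule tensor_lift(2)[OF smash_inner_Delta_bilinear])

lemma smash_fls_linear: "clinear (\<lambda>s. smash_fls s t)" "clinear (smash_fls s)"
proof -
  show lin: "clinear (\<lambda>s. smash_fls s t)" for t
    unfolding smash_fls_def by (rule tensor_lift(1)[OF smash_outer_bilinear])
  have elem: "clinear (smash_fls (u \<otimes>\<^sub>C h))" for u h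
    unfolding smash_fls_def tensor_lift(2)[OF smash_outer_bilinear]
    by (rule tensor_lift(1)[OF smash_inner_Delta_bilinear])
  show "clinear (smash_fls s)"
    by (induction s rule: tensor_induct)
      (simp_all only: elem clinearD(1)[OF lin] clinear_add)
qed

lemma smash_Y_nth: "smash_Y heis_Y heis_Y heis_Delta Y_M s t n = smash_fls s t $$ n"
proof -
  have inner: "smash_inner u v k x $$ n = tensor_lift (\<lambda>h1 h2.
      Sum_any (\<lambda>(i, j). heis_Y u (Y_M h1 v j) i \<otimes>\<^sub>C heis_Y h2 k (n - i - j))) x" for u v k x
    unfolding smash_inner_def tensor_lift_compose[OF smash_core_linear(4) clinear_fls_nth]
      smash_core_nth ..
  show ?thesis
    unfolding smash_Y_def smash_fls_def tensor_lift_compose[OF smash_outer_bilinear clinear_fls_nth]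
      tensor_lift_compose[OF smash_inner_Delta_bilinear clinear_fls_nth] inner ..
qed

lemma smash_inner_vacuum: "smash_inner 1 v k 1 = fls_const (v \<otimes>\<^sub>C k)"
  unfolding one_tensor_def smash_inner_elem smash_core_def alg_homD(3)[OF heis_exp_hom]
    Y_M_vacuum[OF form module Y_M_gen] fls_const_1[symmetric]
  by (simp add: fls_map_const cbilinearD[OF cbilinear_tensor_elem] tensor_mult flip: one_tensor_def del: fls_const_1)

lemma smash_fls_vacuum: "smash_fls 1 t = fls_const t"
  unfolding one_tensor_def
  by (rule tensor_eq[OF smash_fls_linear(2) clinear_fls_const])
    (simp add: smash_fls_elem alg_homD[OF heis_Delta(1)] smash_inner_vacuum)

text \<open>Multiplying u \<otimes> h by \<Delta>(\<alpha>(-m)) and then taking the coproduct of the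
  second factor puts \<alpha>(-m) on u, on h(1) or on h(2). The cases of u and h(2) use
  multiplicativity of the exponential; that of h(1), in \<open>smash_inner_gen_module\<close>, uses
  the recursion for \<open>Y_M\<close>.\<close>

lemma smash_inner_gen_left:
  "smash_inner (heis_gen \<alpha> n * u) v k x = left_fls (heis_exp (heis_gen \<alpha> n)) * smash_inner u v k x"
  by (rule tensor_eq[OF smash_inner_linear(4) clinear_mult_left[OF smash_inner_linear(4)]])
    (simp add: smash_inner_elem smash_core_def alg_homD(2)[OF heis_exp_hom] left_right_fls_mult mult_ac)

lemma smash_inner_gen_right:
  "smash_inner u v k ((1 \<otimes>\<^sub>C heis_gen \<alpha> n) * x) = right_fls (heis_exp (heis_gen \<alpha> n)) * smash_inner u v k x"
  by (rule tensor_eq[OF clinear_compose[OF clinear_mult_left[OF clinear_id] smash_inner_linear(4)]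
        clinear_mult_left[OF smash_inner_linear(4)]])
    (simp add: tensor_mult smash_inner_elem smash_core_def alg_homD(2)[OF heis_exp_hom] left_right_fls_mult mult_ac)

lemma clinear_sum:
  assumes "\<And>i. i \<in> A \<Longrightarrow> clinear (f i)"
  shows "clinear (\<lambda>x. \<Sum>i\<in>A. f i x)"
  using assms by (intro clinearI) (simp_all add: clinearD sum.distrib cvs.scale_sum_right)

lemma smash_inner_gen_module:
  assumes N: "\<And>n. n \<ge> N \<Longrightarrow> ann form \<alpha> n v = 0"
  shows "smash_inner u v k ((heis_gen \<alpha> (Suc p) \<otimes>\<^sub>C 1) * x) =
    (\<Sum>n<N. ann_coeff p n *\<^sub>C fls_shift (int (Suc n) + int p) (smash_inner u (ann form \<alpha> n v) k x))"
proof (rule tensor_eq[OF clinear_compose[OF clinear_mult_left[OF clinear_id] smash_inner_linear(4)]])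
  show "clinear (\<lambda>x. \<Sum>n<N. ann_coeff p n *\<^sub>C fls_shift (int (Suc n) + int p) (smash_inner u (ann form \<alpha> n v) k x))"
    by (intro clinear_sum clinear_scale clinear_compose[OF smash_inner_linear(4) clinear_fls_shift])
  fix a b
  show "smash_inner u v k ((heis_gen \<alpha> (Suc p) \<otimes>\<^sub>C 1) * (a \<otimes>\<^sub>C b)) =
    (\<Sum>n<N. ann_coeff p n *\<^sub>C fls_shift (int (Suc n) + int p) (smash_inner u (ann form \<alpha> n v) k (a \<otimes>\<^sub>C b)))"
    by (simp add: tensor_mult smash_inner_elem smash_core_def M_iterate[OF form module Y_M_gen N]
        clinearD[OF left_right_fls_linear(1)] fls_map_shift cbilinearD[OF cbilinear_tensor_elem]
        sum_distrib_left sum_distrib_right scaleC_mult_left scaleC_mult_right fls_shifted_times_simps)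
qed

section \<open>Matching the recursions under the coproduct\<close>

definition ann_left :: "'h \<Rightarrow> nat \<Rightarrow> ('h heis, 'h heis) tensor \<Rightarrow> ('h heis, 'h heis) tensor"
  where "ann_left \<alpha> n = tensor_lift (\<lambda>a b. ann form \<alpha> n a \<otimes>\<^sub>C b)"

lemma ann_left: "clinear (ann_left \<alpha> n)" "ann_left \<alpha> n (a \<otimes>\<^sub>C b) = ann form \<alpha> n a \<otimes>\<^sub>C b"
proof -
  have bil: "cbilinear (\<lambda>a b. ann form \<alpha> n a \<otimes>\<^sub>C b)"
    unfolding cbilinear_def
    by (intro conjI allI cbilinearD[OF cbilinear_tensor_elem]
        clinear_compose[OF derivationD(1)[OF ann_derivation[OF form]] cbilinearD(2)[OF cbilinear_tensor_elem]])
  show "clinear (ann_left \<alpha> n)" "ann_left \<alpha> n (a \<otimes>\<^sub>C b) = ann form \<alpha> n a \<otimes>\<^sub>C b"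
    unfolding ann_left_def by (rule tensor_lift[OF bil])+
qed

text \<open>On \<Delta>(\<beta>(-p-1)) the operator \<alpha>(n) \<otimes> 1 sees only the left
  summand and yields the same scalar as \<alpha>(n) on \<beta>(-p-1). Both sides thus obey the same
  Leibniz rule in the generators.\<close>

lemma ann_left_Delta: "ann_left \<alpha> n (heis_Delta x) = heis_Delta (ann form \<alpha> n x)"
proof (induction x rule: heis_induct)
  case one
  show ?case
    by (simp add: alg_homD[OF heis_Delta(1)] clinearD[OF alg_homD(1)[OF heis_Delta(1)]]
        one_tensor_def ann_left(2) ann_1[OF form] tensor_elem_linear)
next
  case (gen \<beta> p x)
  let ?c = "if n = Suc p then of_nat n * form \<alpha> \<beta> else 0"
  have "ann_left \<alpha> n (heis_Delta (heis_gen \<beta> (Suc p)) * s)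
      = ?c *\<^sub>C s + heis_Delta (heis_gen \<beta> (Suc p)) * ann_left \<alpha> n s" for s
  proof (induction s rule: tensor_induct)
    case (elem a b)
    show ?case
      by (simp only: heis_Delta(2) distrib_right tensor_mult mult_1 clinearD[OF ann_left(1)] ann_left(2)
          ann_gen_mult[OF form] tensor_elem_linear add_ac)
  qed (simp add: distrib_left clinearD[OF ann_left(1)] scaleC_add_right)
  with gen show ?case
    by (simp only: alg_homD(2)[OF heis_Delta(1)] ann_gen_mult[OF form]
        clinearD[OF alg_homD(1)[OF heis_Delta(1)]])
qed (simp_all add: clinearD[OF alg_homD(1)[OF heis_Delta(1)]] clinearD[OF ann_left(1)] ann_linear[OF form])

text \<open>Each coefficient of the exponential series is a multiple of a generator, hence
  primitive.\<close>

lemma fls_map_Delta_gen: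
  "fls_map heis_Delta (heis_exp (heis_gen \<alpha> (Suc p)))
    = left_fls (heis_exp (heis_gen \<alpha> (Suc p))) + right_fls (heis_exp (heis_gen \<alpha> (Suc p)))"
proof (rule fls_eqI)
  fix k
  note lin = alg_homD(1)[OF heis_Delta(1)]
  show "fls_map heis_Delta (heis_exp (heis_gen \<alpha> (Suc p))) $$ k
    = (left_fls (heis_exp (heis_gen \<alpha> (Suc p))) + right_fls (heis_exp (heis_gen \<alpha> (Suc p)))) $$ k"
    by (cases k) (simp_all add: lin cbilinearD[OF cbilinear_tensor_elem] heis_exp_gen clinearD[OF lin]
        heis_Delta(2) tensor_elem_linear scaleC_add_right heis_exp_nth[of _ "- int _"] heis_exp_nth[of _ "- 1 - int _"])
qed

text \<open>The cutoff N depends on the tensor t: for v \<otimes> k it must bound the modes of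
  \<alpha> acting on v. Stating the identity for all large N lets sums of tensors share a
  cutoff.\<close>

lemma smash_fls_gen:
  "\<forall>\<^sub>F N in sequentially. smash_fls (heis_Delta (heis_gen \<alpha> (Suc p)) * s) t =
    fls_map heis_Delta (heis_exp (heis_gen \<alpha> (Suc p))) * smash_fls s t
    + (\<Sum>n<N. ann_coeff p n *\<^sub>C fls_shift (int (Suc n) + int p) (smash_fls s (ann_left \<alpha> n t)))"
proof (induction s rule: tensor_induct)
  case (elem u h)
  show ?case
  proof (induction t rule: tensor_induct)
    case (elem v k)
    obtain N0 where N0: "\<And>n. n \<ge> N0 \<Longrightarrow> ann form \<alpha> n v = 0"
      using ann_finite_M[OF form module Y_M_gen] by blast
    show ?case
    proof (rule eventually_sequentiallyI[of N0])
      fix N assume "N0 \<le> N"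
      then have N: "\<And>n. n \<ge> N \<Longrightarrow> ann form \<alpha> n v = 0" using N0 by simp
      show "smash_fls (heis_Delta (heis_gen \<alpha> (Suc p)) * (u \<otimes>\<^sub>C h)) (v \<otimes>\<^sub>C k) =
        fls_map heis_Delta (heis_exp (heis_gen \<alpha> (Suc p))) * smash_fls (u \<otimes>\<^sub>C h) (v \<otimes>\<^sub>C k)
        + (\<Sum>n<N. ann_coeff p n *\<^sub>C fls_shift (int (Suc n) + int p) (smash_fls (u \<otimes>\<^sub>C h) (ann_left \<alpha> n (v \<otimes>\<^sub>C k))))"
        by (simp only: heis_Delta(2) distrib_right tensor_mult mult_1 clinearD[OF smash_fls_linear(1)]
            smash_fls_elem alg_homD(2)[OF heis_Delta(1)] clinearD[OF smash_inner_linear(4)]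
            smash_inner_gen_left smash_inner_gen_right smash_inner_gen_module[OF N]
            fls_map_Delta_gen ann_left(2) add_ac)
    qed
  next
    case (add t t')
    then show ?case
      by eventually_elim (simp add: clinearD[OF smash_fls_linear(2)] clinearD[OF ann_left(1)]
        clinearD[OF clinear_fls_shift] scaleC_add_right sum.distrib distrib_left)
  qed
next
  case (add s s')
  then show ?case
    by eventually_elim (simp add: clinearD[OF smash_fls_linear(1)]
      clinearD[OF clinear_fls_shift] scaleC_add_right sum.distrib distrib_left)
qed

lemma Delta_field:
  assumes va: "nonlocal_vertex_algebra UNIV Y 1"
    and gen: "\<And>\<alpha> v k. Y (heis_gen \<alpha> 1) v k = heis_plus form \<alpha> v k + heis_minus form \<alpha> v k"
  shows "fls_map heis_Delta (field_fls Y u w) = smash_fls (heis_Delta u) (heis_Delta w)"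
proof -
  have Y: "vertex_operator_map UNIV UNIV Y" and vac: "Y 1 v k = (if k = 0 then v else 0)" for v k
    using va by (auto simp: nonlocal_vertex_algebra_def)
  note lin = alg_homD(1)[OF heis_Delta(1)]
  note linD = clinearD[OF lin] clinearD[OF clinear_fls_map[OF lin]]
    clinearD[OF smash_fls_linear(1)] clinearD[OF cbilinearD(2)[OF field_fls(2)[OF Y]]]
  show ?thesis
  proof (induction u arbitrary: w rule: heis_induct)
    case one
    have "field_fls Y 1 w = fls_const w"
      by (rule fls_eqI) (simp add: field_fls(1)[OF Y] vac)
    then show ?case
      by (simp add: fls_map_const[OF lin] alg_homD[OF heis_Delta(1)] smash_fls_vacuum)
  next
    case (gen \<alpha> p x)
    have "\<forall>\<^sub>F N in sequentially. \<forall>n\<ge>N. ann form \<alpha> n w = 0"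
      using ann_finite_M[OF form module Y_M_gen, of \<alpha> w]
      by (auto simp: eventually_sequentially intro: order_trans)
    \<comment> \<open>A single N must serve both the recursion in M(1) and the one in the smash
      product, so that the two finite sums agree term by term.\<close>
    from eventually_happens'[OF sequentially_bot eventually_conj[OF this smash_fls_gen[of \<alpha> p "heis_Delta x" "heis_Delta w"]]]
    obtain N where N: "\<And>n. n \<ge> N \<Longrightarrow> ann form \<alpha> n w = 0"
      and S: "smash_fls (heis_Delta (heis_gen \<alpha> (Suc p)) * heis_Delta x) (heis_Delta w) =
        fls_map heis_Delta (heis_exp (heis_gen \<alpha> (Suc p))) * smash_fls (heis_Delta x) (heis_Delta w)
        + (\<Sum>n<N. ann_coeff p n *\<^sub>C fls_shift (int (Suc n) + int p) (smash_fls (heis_Delta x) (ann_left \<alpha> n (heis_Delta w))))"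
      by blast
    show ?case
      by (simp only: alg_homD(2)[OF heis_Delta(1)] S M1_iterate[OF form va assms(2) N] linD
          fls_map_mult[OF lin alg_homD(2)[OF heis_Delta(1)]] fls_map_shift[OF lin] gen ann_left_Delta)
  qed (simp_all add: linD)
qed

end


section \<open>Transport of vertex algebra structures\<close>

text \<open>The axioms are linear identities in the modes, so applying \<phi> carries them to its
  range. Injectivity keeps the support of each \<open>Sum_any\<close> unchanged.\<close>

lemma vertex_algebra_transport:
  fixes \<phi> :: "'v::complex_vector \<Rightarrow> 'w::complex_vector"
  assumes va: "vertex_algebra UNIV Y vac" and lin: "clinear \<phi>" and inj: "inj \<phi>"
    and hom: "\<And>u v n. Y' (\<phi> u) (\<phi> v) n = \<phi> (Y u v n)"
  shows "vertex_algebra (range \<phi>) Y' (\<phi> vac)"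
proof -
  note L = clinearD(1,2,4,6)[OF lin, symmetric]
  have zero: "\<phi> x = 0 \<longleftrightarrow> x = 0" for x
    using inj by (metis clinearD(3)[OF lin] injD)
  have Sum_any: "Sum_any (\<lambda>j::nat. \<phi> (f j)) = \<phi> (Sum_any f)" for f
    unfolding Sum_any.expand_set by (simp add: zero clinearD[OF lin])
  have nva: "nonlocal_vertex_algebra UNIV Y vac" and loc: "\<And>u v. locality UNIV Y u v"
    using va by (auto simp: vertex_algebra_def)
  have vom: "vertex_operator_map UNIV UNIV Y"
    and vac: "\<And>v n. Y vac v n = (if n = 0 then v else 0)"
    "\<And>v n. n < 0 \<Longrightarrow> Y v vac n = 0" "\<And>v. Y v vac 0 = v"
    and assoc: "\<And>u v w. weak_associativity Y Y u v w"
    using nva by (auto simp: nonlocal_vertex_algebra_def)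
  have "cvs.subspace (range \<phi>)"
    unfolding cvs.subspace_def by (auto simp: L image_iff zero intro: exI[of _ 0] dest: sym)
  moreover have "vertex_operator_map (range \<phi>) (range \<phi>) Y'"
    using vom unfolding vertex_operator_map_def clinear_on_def by (auto simp: hom L zero)
  moreover have "weak_associativity Y' Y' (\<phi> u) (\<phi> v) (\<phi> w)" for u v w
    using assoc[of u v w] unfolding weak_associativity_def hom L Sum_any by (auto dest: arg_cong[of _ _ \<phi>])
  moreover have "locality (range \<phi>) Y' (\<phi> u) (\<phi> v)" for u v
    using loc[of u v] unfolding locality_def by (auto simp: hom L zero)
  ultimately show ?thesis
    unfolding vertex_algebra_def nonlocal_vertex_algebra_def
    by (auto simp: hom vac clinearD[OF lin])
qed

theorem proposition5p2:
  fixes form :: "'h::complex_vector \<Rightarrow> 'h \<Rightarrow> complex"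
    and Y_M Y_M1 :: "'h heis \<Rightarrow> 'h heis \<Rightarrow> 'h heis series"
  assumes fin_dim: "\<exists>S::'h set. finite S \<and> cvs.span S = UNIV"
    and bilinear: "cbilinear form"
    and symmetric: "\<And>a b. form a b = form b a"
    and nondegenerate: "\<And>a. (\<And>b. form a b = 0) \<Longrightarrow> a = 0"
    and Y_M_module: "va_module UNIV heis_Y 1 UNIV Y_M"
    and Y_M_gen: "\<And>\<alpha> v. Y_M (heis_gen \<alpha> 1) v = heis_minus form \<alpha> v"
    and Y_M1_vertex_algebra: "vertex_algebra UNIV Y_M1 1"
    and Y_M1_gen: "\<And>\<alpha> v k. Y_M1 (heis_gen \<alpha> 1) v k = heis_plus form \<alpha> v k + heis_minus form \<alpha> v k"
  shows "vertex_subalgebra (range heis_Delta) UNIV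
           (smash_Y heis_Y heis_Y heis_Delta Y_M) (1 \<otimes>\<^sub>C 1)
       \<and> va_isomorphism UNIV Y_M1 1
           (range heis_Delta) (smash_Y heis_Y heis_Y heis_Delta Y_M) (1 \<otimes>\<^sub>C 1) heis_Delta"
proof -
  have nva: "nonlocal_vertex_algebra UNIV Y_M1 1"
    using Y_M1_vertex_algebra by (simp add: vertex_algebra_def)
  then have Y: "vertex_operator_map UNIV UNIV Y_M1"
    by (simp add: nonlocal_vertex_algebra_def)
  note lin = alg_homD(1)[OF heis_Delta(1)]
  have hom: "smash_Y heis_Y heis_Y heis_Delta Y_M (heis_Delta u) (heis_Delta v) n = heis_Delta (Y_M1 u v n)"
    for u v n
    unfolding smash_Y_nth[OF bilinear Y_M_module Y_M_gen]
      Delta_field[OF bilinear Y_M_module Y_M_gen nva Y_M1_gen, symmetric]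
    by (simp add: lin field_fls(1)[OF Y])
  have one: "heis_Delta (1 :: 'h heis) = 1 \<otimes>\<^sub>C 1"
    by (simp add: alg_homD(3)[OF heis_Delta(1)] one_tensor_def)
  have "vertex_algebra (range heis_Delta) (smash_Y heis_Y heis_Y heis_Delta Y_M) (1 \<otimes>\<^sub>C 1)"
    unfolding one[symmetric]
    by (rule vertex_algebra_transport[where Y = Y_M1])
      (fact Y_M1_vertex_algebra lin inj_heis_Delta hom)+
  moreover have "clinear_on UNIV (heis_Delta :: 'h heis \<Rightarrow> _)"
    by (simp add: clinear_on_def clinearD[OF lin])
  ultimately show ?thesis
    by (simp add: vertex_subalgebra_def va_isomorphism_def one hom inj_heis_Delta inj_on_imp_bij_betw)
qed

end
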